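(* Let $h(t):=2^{4t+1}+2$, $g(t):=2h(t)^2$, $c_k:=\frac83(k+1)^2 2^{4k}$, and $f(t):=4c_{g(t)}2^{4c_{g(t)}+2}$. Every $K_t$-minor free graph has twin-width at most $f(t)=2^{2^{2^{O(t)}}}$.
   Context: Graphs are finite, simple, undirected. Twin-width: a trigraph is a triple $(V,E,R)$ with $E,R$ disjoint sets of unordered pairs of distinct vertices (black and red edges); a graph $(V,E)$ is identified with $(V,E,\emptyset)$. Contracting two distinct vertices $u,v$ (not necessarily adjacent) replaces them by a new vertex $w$, keeps the rest unchanged, and for every other vertex $x$: $wx$ is black iff $ux,vx$ are both black; $wx$ is absent iff neither $ux$ nor $vx$ is a black or red edge; $wx$ is red otherwise. The twin-width of an $n$-vertex graph $G$ is the least $d$ such that there is a sequence $G=G_n,\ldots,G_1$, each obtained from the previous by one contraction, $G_1$ a single vertex, with every $G_i$ of maximum red degree at most $d$. A graph is $K_t$-minor free if $K_t$ cannot be obtained from it by vertex deletions, edge deletions and (usual) edge contractions. *)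

theory Defs
  imports "HOL-Library.Ramsey" "HOL-Library.Landau_Symbols"
begin

text \<open>
  A graph is a pair (V, E) and a trigraph a triple (V, E, R) with black edges E and red edges R.
  Edges are two-element sets, \<^term>\<open>nsets V 2\<close> being the set of all unordered pairs of
  distinct elements of V.
\<close>

type_synonym 'a graph = "'a set \<times> 'a set set"
type_synonym 'a trigraph = "'a set \<times> 'a set set \<times> 'a set set"

fun vertices :: "'a graph \<Rightarrow> 'a set" where
  "vertices (V, E) = V"

fun finite_simple_graph :: "'a graph \<Rightarrow> bool" where
  "finite_simple_graph (V, E) \<longleftrightarrow> finite V \<and> E \<subseteq> nsets V 2"

fun trigraph_of :: "'a graph \<Rightarrow> 'a trigraph" where
  "trigraph_of (V, E) = (V, E, {})"

fun tri_vertices :: "'a trigraph \<Rightarrow> 'a set" where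
  "tri_vertices (V, E, R) = V"

fun trigraph :: "'a trigraph \<Rightarrow> bool" where
  "trigraph (V, E, R) \<longleftrightarrow> finite V \<and> E \<subseteq> nsets V 2 \<and> R \<subseteq> nsets V 2 \<and> E \<inter> R = {}"

fun red_degree :: "'a trigraph \<Rightarrow> 'a \<Rightarrow> nat" where
  "red_degree (V, E, R) x = card {e \<in> R. x \<in> e}"

definition max_red_degree_le :: "nat \<Rightarrow> 'a trigraph \<Rightarrow> bool" where
  "max_red_degree_le d T \<longleftrightarrow> (\<forall>x \<in> tri_vertices T. red_degree T x \<le> d)"

fun contract :: "'a \<Rightarrow> 'a \<Rightarrow> 'a \<Rightarrow> 'a trigraph \<Rightarrow> 'a trigraph" where
  "contract u v w (V, E, R) =
    (let X = V - {u, v} in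
      (insert w X,
       (E \<inter> nsets X 2) \<union> {{w, x} | x. x \<in> X \<and> {u, x} \<in> E \<and> {v, x} \<in> E},
       (R \<inter> nsets X 2) \<union>
         {{w, x} | x. x \<in> X \<and> \<not> ({u, x} \<in> E \<and> {v, x} \<in> E)
                            \<and> \<not> ({u, x} \<notin> E \<union> R \<and> {v, x} \<notin> E \<union> R)}))"

text \<open>
  The new vertex w has to differ from the vertices that are kept, but it may reuse the name u or v:
  otherwise no contraction would be possible when V exhausts the type of vertices.
\<close>

definition contraction_step :: "'a trigraph \<Rightarrow> 'a trigraph \<Rightarrow> bool" where
  "contraction_step T T' \<longleftrightarrow>
    (\<exists>u v w. u \<in> tri_vertices T \<and> v \<in> tri_vertices T \<and> u \<noteq> v \<and>
             w \<notin> tri_vertices T - {u, v} \<and> T' = contract u v w T)"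

definition contraction_sequence :: "'a graph \<Rightarrow> 'a trigraph list \<Rightarrow> bool" where
  "contraction_sequence G Ts \<longleftrightarrow>
    Ts \<noteq> [] \<and> hd Ts = trigraph_of G \<and> successively contraction_step Ts \<and>
    card (tri_vertices (last Ts)) = 1"

definition twin_width :: "'a graph \<Rightarrow> nat" where
  "twin_width G =
    (LEAST d. \<exists>Ts. contraction_sequence G Ts \<and> (\<forall>T \<in> set Ts. max_red_degree_le d T))"

text \<open>
  Contraction keeps trigraphs trigraphs, and the minimum defining twin-width is taken over a
  nonempty set for every nonempty finite graph (the empty graph has no contraction sequence).
\<close>

lemma trigraph_trigraph_of: "finite_simple_graph G \<Longrightarrow> trigraph (trigraph_of G)"
  by (cases G) auto

lemma trigraph_contraction_step:
  assumes "trigraph T" "contraction_step T T'"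
  shows "trigraph T'" "Suc (card (tri_vertices T')) = card (tri_vertices T)"
proof -
  obtain V E R where T: "T = (V, E, R)" by (cases T)
  obtain u v w where *: "u \<in> V" "v \<in> V" "u \<noteq> v" "w \<notin> V - {u, v}" "T' = contract u v w T"
    using assms(2) by (auto simp: contraction_step_def T)
  have fin: "finite V" using assms(1) by (simp add: T)
  define X where "X = V - {u, v}"
  have X: "w \<notin> X" "finite X" using * fin by (auto simp: X_def)
  have T': "T' = (insert w X,
       (E \<inter> nsets X 2) \<union> {{w, x} | x. x \<in> X \<and> {u, x} \<in> E \<and> {v, x} \<in> E},
       (R \<inter> nsets X 2) \<union>
         {{w, x} | x. x \<in> X \<and> \<not> ({u, x} \<in> E \<and> {v, x} \<in> E)
                            \<and> \<not> ({u, x} \<notin> E \<union> R \<and> {v, x} \<notin> E \<union> R)})"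
    unfolding *(5) T X_def contract.simps Let_def by (rule refl)
  have 1: "nsets X 2 \<subseteq> nsets (insert w X) 2"
    by (intro nsets_mono) auto
  have 2: "{w, x} \<notin> nsets X 2" for x using X by (simp)
  have 3: "{w, x} = {w, y} \<longleftrightarrow> x = y" for x y by (auto simp: doubleton_eq_iff)
  have 4: "E \<inter> R = {}" using assms(1) by (simp add: T)
  show "trigraph T'"
    unfolding T' trigraph.simps
  proof (intro conjI)
    show "finite (insert w X)" using X by simp
    have w: "{w, x} \<in> nsets (insert w X) 2" if "x \<in> X" for x
      using that X(1) by auto
    show "(E \<inter> nsets X 2) \<union> {{w, x} | x. x \<in> X \<and> {u, x} \<in> E \<and> {v, x} \<in> E}
        \<subseteq> nsets (insert w X) 2"
      using 1 w by blast
    show "(R \<inter> nsets X 2) \<union>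
         {{w, x} | x. x \<in> X \<and> \<not> ({u, x} \<in> E \<and> {v, x} \<in> E)
                            \<and> \<not> ({u, x} \<notin> E \<union> R \<and> {v, x} \<notin> E \<union> R)}
        \<subseteq> nsets (insert w X) 2"
      using 1 w by blast
    have "(E \<inter> N \<union> {{w, x} | x. P x}) \<inter> (R \<inter> N \<union> {{w, x} | x. Q x}) = {}"
      if N: "\<And>x. {w, x} \<notin> N" and PQ: "\<And>x. P x \<Longrightarrow> \<not> Q x" for N P Q
    proof (rule equals0I)
      fix e
      assume e: "e \<in> (E \<inter> N \<union> {{w, x} | x. P x}) \<inter> (R \<inter> N \<union> {{w, x} | x. Q x})"
      show False
      proof (cases "e \<in> N")
        case True
        then have "e \<in> E \<inter> R" using e N by blast
        then show False using 4 by simp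
      next
        case False
        then obtain x y where "e = {w, x}" "P x" "e = {w, y}" "Q y" using e by blast
        then show False using PQ 3 by metis
      qed
    qed
    note disj = this
    show "(E \<inter> nsets X 2 \<union> {{w, x} | x. x \<in> X \<and> {u, x} \<in> E \<and> {v, x} \<in> E}) \<inter>
       (R \<inter> nsets X 2 \<union>
         {{w, x} | x. x \<in> X \<and> \<not> ({u, x} \<in> E \<and> {v, x} \<in> E)
                            \<and> \<not> ({u, x} \<notin> E \<union> R \<and> {v, x} \<notin> E \<union> R)}) = {}"
      by (rule disj[OF 2]) blast
  qed
  have "card (V - {u, v}) = card V - 2"
    using * fin by (simp add: card_Diff_subset)
  moreover have "card V \<ge> 2"
    using card_mono[of V "{u, v}"] * fin by auto
  ultimately show "Suc (card (tri_vertices T')) = card (tri_vertices T)"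
    using * fin by (simp add: T Let_def)
qed

lemma trigraph_chain:
  "successively contraction_step (T # Ts) \<Longrightarrow> trigraph T \<Longrightarrow> S \<in> set (T # Ts) \<Longrightarrow> trigraph S"
proof (induction Ts arbitrary: T)
  case (Cons T' Ts)
  have "contraction_step T T'" and chain: "successively contraction_step (T' # Ts)"
    using Cons.prems(1) by (simp_all only: successively.simps)
  then have "trigraph T'"
    using Cons.prems(2) trigraph_contraction_step(1) by blast
  then show ?case
    using Cons.IH[OF chain] Cons.prems(2,3) by (metis set_ConsD)
qed simp

lemma ex_contraction_chain:
  assumes "trigraph T" "tri_vertices T \<noteq> {}"
  shows "\<exists>Ts. Ts \<noteq> [] \<and> hd Ts = T \<and> successively contraction_step Ts \<and>
              card (tri_vertices (last Ts)) = 1"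
  using assms
proof (induction "card (tri_vertices T)" arbitrary: T rule: less_induct)
  case less
  show ?case
  proof (cases "card (tri_vertices T) = 1")
    case True
    then show ?thesis by (intro exI[of _ "[T]"]) auto
  next
    case False
    obtain V E R where T: "T = (V, E, R)" by (cases T)
    have fin: "finite V" and ne: "V \<noteq> {}" using less.prems by (auto simp: T)
    then have "card V > 1" using False by (simp add: T nat_neq_iff)
    then obtain u v where uv: "u \<in> V" "v \<in> V" "u \<noteq> v"
      using fin by (metis card_le_Suc0_iff_eq not_less One_nat_def)
    define T' where "T' = contract u v u T"
    have step: "contraction_step T T'"
      unfolding contraction_step_def T'_def using uv by (auto simp: T)
    note T' = trigraph_contraction_step[OF less.prems(1) step]
    have "tri_vertices T' \<noteq> {}" by (auto simp: T'_def T Let_def)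
    then obtain Ts where Ts: "Ts \<noteq> []" "hd Ts = T'" "successively contraction_step Ts"
        "card (tri_vertices (last Ts)) = 1"
      using less.hyps[of T'] T' by auto
    then show ?thesis
      using step by (intro exI[of _ "T # Ts"]) (auto simp: successively_Cons)
  qed
qed

lemma twin_width_attained:
  assumes "finite_simple_graph G" "vertices G \<noteq> {}"
  shows "\<exists>Ts. contraction_sequence G Ts \<and> (\<forall>T \<in> set Ts. max_red_degree_le (twin_width G) T)"
proof -
  have V: "tri_vertices (trigraph_of G) = vertices G" by (cases G) simp
  obtain Ts where Ts: "Ts \<noteq> []" "hd Ts = trigraph_of G" "successively contraction_step Ts"
      "card (tri_vertices (last Ts)) = 1"
    using ex_contraction_chain[OF trigraph_trigraph_of[OF assms(1)]] assms(2) V by auto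
  have tri: "\<forall>T \<in> set Ts. trigraph T"
    using trigraph_chain[of "hd Ts" "tl Ts"] Ts(1-3) trigraph_trigraph_of[OF assms(1)]
    by (metis list.collapse)
  define N where "N = (\<Sum>T \<in> set Ts. \<Sum>x \<in> tri_vertices T. red_degree T x)"
  have "max_red_degree_le N T" if "T \<in> set Ts" for T
    unfolding max_red_degree_le_def
  proof
    fix x assume x: "x \<in> tri_vertices T"
    have "finite (tri_vertices T)" using tri that by (cases T) auto
    then have "red_degree T x \<le> (\<Sum>x \<in> tri_vertices T. red_degree T x)"
      using x by (intro member_le_sum) auto
    also have "\<dots> \<le> N" unfolding N_def using that
      by (intro member_le_sum[where f = "\<lambda>T. \<Sum>x \<in> tri_vertices T. red_degree T x"]) auto
    finally show "red_degree T x \<le> N" .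
  qed
  then have "\<exists>Ts. contraction_sequence G Ts \<and> (\<forall>T \<in> set Ts. max_red_degree_le N T)"
    using Ts by (auto simp: contraction_sequence_def)
  then show ?thesis unfolding twin_width_def by (rule LeastI)
qed

inductive minor_step :: "'a graph \<Rightarrow> 'a graph \<Rightarrow> bool" where
  delete_vertex: "v \<in> V \<Longrightarrow> minor_step (V, E) (V - {v}, E \<inter> nsets (V - {v}) 2)"
| delete_edge: "e \<in> E \<Longrightarrow> minor_step (V, E) (V, E - {e})"
| contract_edge: "\<lbrakk>{u, v} \<in> E; u \<noteq> v; w \<notin> V - {u, v}; X = V - {u, v}\<rbrakk> \<Longrightarrow>
    minor_step (V, E)
      (insert w X,
       (E \<inter> nsets X 2) \<union> {{w, x} | x. x \<in> X \<and> ({u, x} \<in> E \<or> {v, x} \<in> E)})"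

text \<open>
  Any complete graph on t vertices counts as a copy of \<open>K\<^sub>t\<close>. Deleting all vertices is allowed, so
  the empty graph is a minor of every finite graph.
\<close>

definition K_minor_free :: "nat \<Rightarrow> 'a graph \<Rightarrow> bool" where
  "K_minor_free t G \<longleftrightarrow>
    \<not> (\<exists>V. finite V \<and> card V = t \<and> minor_step\<^sup>*\<^sup>* G (V, nsets V 2))"

definition h_bound :: "nat \<Rightarrow> nat" where
  "h_bound t = 2 ^ (4 * t + 1) + 2"

definition g_bound :: "nat \<Rightarrow> nat" where
  "g_bound t = 2 * (h_bound t)\<^sup>2"

definition c_bound :: "nat \<Rightarrow> real" where
  "c_bound k = 8 / 3 * (real k + 1)\<^sup>2 * 2 ^ (4 * k)"

definition f_bound :: "nat \<Rightarrow> real" where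
  "f_bound t = 4 * c_bound (g_bound t) * 2 powr (4 * c_bound (g_bound t) + 2)"

end

theory Submission
  imports Defs
begin

text \<open>
  A $K_t$-minor free graph with at least two vertices has two vertices of bounded degree that are
  adjacent or have the same neighbourhood: if the low-degree vertices were independent with distinct
  neighbourhoods, their number would be linear in the number of high-degree vertices, of which
  there are few. Merging such a pair (an edge contraction or the deletion of a twin) again gives a
  $K_t$-minor free graph. Iterating yields coarser and coarser partitions of V whose quotient
  graphs are minors of G and in which every part with more than one vertex has bounded degree in
  the quotient; only singleton parts may have large degree. Splitting each part according to
  the neighbourhoods of its vertices in the union of the singleton parts makes everything
  homogeneous towards the singleton parts, and each part splits into boundedly many pieces. These
  refined partitions also get coarser, and every partition between two consecutive ones has bounded
  red degree, so contracting pairs one by one along this chain is a contraction sequence.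
\<close>

subsection \<open>Complete minors\<close>

definition nbs :: "'a set \<Rightarrow> ('a \<Rightarrow> 'a \<Rightarrow> bool) \<Rightarrow> 'a \<Rightarrow> 'a set" where
  "nbs V A x = {y \<in> V. A x y}"

text \<open>Ordered pairs, so that for symmetric irreflexive \<open>A\<close> the cardinality is the
  degree sum, that is, twice the number of edges.\<close>

definition arcs :: "'a set \<Rightarrow> ('a \<Rightarrow> 'a \<Rightarrow> bool) \<Rightarrow> ('a \<times> 'a) set" where
  "arcs V A = {(x, y). x \<in> V \<and> y \<in> V \<and> A x y}"

text \<open>The contracted vertex keeps the name \<open>u\<close>; removing \<open>v\<close> from
  the vertex set is done separately.\<close>

definition ctr :: "'a \<Rightarrow> 'a \<Rightarrow> ('a \<Rightarrow> 'a \<Rightarrow> bool) \<Rightarrow> 'a \<Rightarrow> 'a \<Rightarrow> bool" where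
  "ctr u v A x y \<longleftrightarrow> x \<noteq> y \<and> (A x y \<or> x = u \<and> A v y \<or> y = u \<and> A x v)"

definition edges_of :: "'a set \<Rightarrow> ('a \<Rightarrow> 'a \<Rightarrow> bool) \<Rightarrow> 'a set set" where
  "edges_of V A = {{x, y} | x y. x \<in> V \<and> y \<in> V \<and> x \<noteq> y \<and> A x y}"

text \<open>
  Graphs are handled as a vertex set with an adjacency predicate, of which only the part between
  distinct vertices of the set counts. The relaxed clique condition in the first rule makes edge
  deletion superfluous.
\<close>

inductive K_minor :: "nat \<Rightarrow> 'a set \<Rightarrow> ('a \<Rightarrow> 'a \<Rightarrow> bool) \<Rightarrow> bool" where
  complete: "\<lbrakk>finite V; card V = t; \<And>x y. \<lbrakk>x \<in> V; y \<in> V; x \<noteq> y\<rbrakk> \<Longrightarrow> A x y\<rbrakk> \<Longrightarrow> K_minor t V A"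
| delete: "\<lbrakk>v \<in> V; K_minor t (V - {v}) A\<rbrakk> \<Longrightarrow> K_minor t V A"
| contract: "\<lbrakk>u \<in> V; v \<in> V; u \<noteq> v; A u v; K_minor t (V - {v}) (ctr u v A)\<rbrakk> \<Longrightarrow> K_minor t V A"

lemma symp_ctr: "symp A \<Longrightarrow> symp (ctr u v A)"
  unfolding symp_def ctr_def by blast

lemma irreflp_ctr: "irreflp (ctr u v A)"
  unfolding irreflp_def ctr_def by blast

lemma finite_nbs: "finite V \<Longrightarrow> finite (nbs V A x)"
  by (simp add: nbs_def)

lemma finite_arcs: "finite V \<Longrightarrow> finite (arcs V A)"
  by (rule finite_subset[of _ "V \<times> V"]) (auto simp: arcs_def)

lemma card_arcs: "finite V \<Longrightarrow> card (arcs V A) = (\<Sum>x\<in>V. card (nbs V A x))"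
proof -
  assume "finite V"
  moreover have "arcs V A = Sigma V (nbs V A)" by (auto simp: arcs_def nbs_def)
  ultimately show ?thesis by (simp add: card_SigmaI finite_nbs)
qed

lemma in_edges_of: "symp A \<Longrightarrow> {x, y} \<in> edges_of V A \<longleftrightarrow> x \<in> V \<and> y \<in> V \<and> x \<noteq> y \<and> A x y"
  by (auto simp: edges_of_def doubleton_eq_iff dest: sympD)

lemma edges_of_delete: "edges_of V A \<inter> nsets (V - {v}) 2 = edges_of (V - {v}) A"
  by (auto simp: edges_of_def) blast

lemma edges_of_ctr:
  assumes "symp A" "u \<in> V" "v \<in> V" "u \<noteq> v"
  shows "edges_of (V - {v}) (ctr u v A) =
    (edges_of V A \<inter> nsets (V - {u, v}) 2) \<union>
    {{u, x} | x. x \<in> V - {u, v} \<and> ({u, x} \<in> edges_of V A \<or> {v, x} \<in> edges_of V A)}"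
    (is "?L = ?R \<union> ?S")
proof
  show "?L \<subseteq> ?R \<union> ?S"
  proof
    fix e assume "e \<in> ?L"
    then obtain x y where e: "e = {x, y}" "x \<in> V - {v}" "y \<in> V - {v}" "x \<noteq> y" "ctr u v A x y"
      by (auto simp: edges_of_def)
    consider "x = u" | "y = u" | "x \<noteq> u" "y \<noteq> u" by blast
    then show "e \<in> ?R \<union> ?S"
    proof cases
      case 1
      then have "y \<in> V - {u, v} \<and> ({u, y} \<in> edges_of V A \<or> {v, y} \<in> edges_of V A)"
        using e assms by (auto simp: in_edges_of ctr_def)
      then show ?thesis using 1 e by blast
    next
      case 2
      then have "x \<in> V - {u, v} \<and> ({u, x} \<in> edges_of V A \<or> {v, x} \<in> edges_of V A)"
        using e assms by (auto simp: in_edges_of ctr_def dest: sympD)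
      then show ?thesis using 2 e by (auto simp: insert_commute)
    next
      case 3
      then have "e \<in> ?R" using e assms by (auto simp: in_edges_of ctr_def)
      then show ?thesis by blast
    qed
  qed
next
  have "?R \<subseteq> ?L"
    using assms by (auto simp: edges_of_def ctr_def) blast
  moreover have "{u, x} \<in> ?L"
    if "x \<in> V - {u, v}" "{u, x} \<in> edges_of V A \<or> {v, x} \<in> edges_of V A" for x
    using that assms by (auto simp: in_edges_of symp_ctr) (auto simp: ctr_def)
  ultimately show "?R \<union> ?S \<subseteq> ?L" by blast
qed

text \<open>Each rule is matched by a step on edge sets, contraction reusing the name
  \<open>u\<close> for the new vertex. In the base case \<open>edges_of V A\<close> already is
  \<open>nsets V 2\<close>.\<close>

lemma K_minor_imp_minor_step:
  "K_minor t V A \<Longrightarrow> symp A \<Longrightarrow>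
    \<exists>W. finite W \<and> card W = t \<and> minor_step\<^sup>*\<^sup>* (V, edges_of V A) (W, nsets W 2)"
proof (induction rule: K_minor.induct)
  case (complete V t A)
  have "edges_of V A = nsets V 2"
    using complete(3) by (fastforce simp: edges_of_def nsets_def card_2_iff)
  then show ?case using complete by auto
next
  case (delete v V t A)
  have "minor_step (V, edges_of V A) (V - {v}, edges_of (V - {v}) A)"
    using minor_step.delete_vertex[OF delete(1), of "edges_of V A"] by (simp only: edges_of_delete)
  then show ?case using delete by (meson converse_rtranclp_into_rtranclp)
next
  case (contract u V v A t)
  have "{u, v} \<in> edges_of V A" using contract by (simp add: in_edges_of)
  then have "minor_step (V, edges_of V A) (insert u (V - {u, v}), edges_of (V - {v}) (ctr u v A))"
    using contract minor_step.contract_edge[of u v "edges_of V A" u V "V - {u, v}"]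
    by (simp add: edges_of_ctr)
  moreover have "insert u (V - {u, v}) = V - {v}" using contract by auto
  moreover have "\<exists>W. finite W \<and> card W = t \<and>
      minor_step\<^sup>*\<^sup>* (V - {v}, edges_of (V - {v}) (ctr u v A)) (W, nsets W 2)"
    by (rule contract.IH[OF symp_ctr[OF contract.prems]])
  ultimately show ?case by (auto intro: converse_rtranclp_into_rtranclp)
qed

text \<open>\<open>ctr\<close> is monotone in the adjacency, so the same operations work in a
  supergraph, and the relaxed clique condition tolerates the surplus edges.\<close>

lemma K_minor_mono_adj:
  "K_minor t V A \<Longrightarrow> (\<And>x y. \<lbrakk>x \<in> V; y \<in> V; x \<noteq> y; A x y\<rbrakk> \<Longrightarrow> B x y) \<Longrightarrow> K_minor t V B"
proof (induction arbitrary: B rule: K_minor.induct)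
  case (complete V t A)
  then show ?case by (intro K_minor.complete) auto
next
  case (delete v V t A)
  then show ?case by (metis DiffD1 K_minor.delete)
next
  case (contract u V v A t)
  have "K_minor t (V - {v}) (ctr u v B)"
    using contract by (intro contract.IH) (auto simp: ctr_def)
  then show ?case using contract.hyps contract.prems by (metis K_minor.contract)
qed

lemma K_minor_mono_vertices:
  assumes "finite V" "W \<subseteq> V" "K_minor t W A"
  shows "K_minor t V A"
proof -
  have "K_minor t (W \<union> X) A" if "finite X" for X
    using that
  proof (induction X rule: finite_induct)
    case (insert x X)
    show ?case
    proof (cases "x \<in> W")
      case True
      then show ?thesis using insert by (simp add: insert_absorb)
    next
      case False
      then have "W \<union> insert x X - {x} = W \<union> X" using insert by auto
      then show ?thesis using insert.IH K_minor.delete[of x "W \<union> insert x X"] by simp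
    qed
  qed (use assms in simp)
  from this[of "V - W"] show ?thesis using assms by (simp add: Un_absorb1)
qed

text \<open>The operations inside \<open>N\<close> leave \<open>z\<close> alone, and
  \<open>z\<close> stays adjacent to all surviving vertices, so it extends the final clique.\<close>

lemma K_minor_apex:
  "\<lbrakk>K_minor t N A; z \<notin> N; \<And>x y. \<lbrakk>x \<in> N; y \<in> N; x \<noteq> y; A x y\<rbrakk> \<Longrightarrow> B x y;
    \<And>x. x \<in> N \<Longrightarrow> B z x \<and> B x z\<rbrakk> \<Longrightarrow> K_minor (Suc t) (insert z N) B"
proof (induction arbitrary: B rule: K_minor.induct)
  case (complete V t A)
  then show ?case by (intro K_minor.complete) auto
next
  case (delete v V t A)
  have "K_minor (Suc t) (insert z (V - {v})) B" using delete by (intro delete.IH) auto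
  moreover have "insert z (V - {v}) = insert z V - {v}" using delete by auto
  ultimately have "K_minor (Suc t) (insert z V - {v}) B" by (simp only:)
  then show ?case using delete(1) K_minor.delete[of v] by blast
next
  case (contract u V v A t)
  have "K_minor (Suc t) (insert z (V - {v})) (ctr u v B)"
    using contract by (intro contract.IH) (auto simp: ctr_def)
  moreover have "insert z (V - {v}) = insert z V - {v}" using contract by auto
  ultimately have "K_minor (Suc t) (insert z V - {v}) (ctr u v B)" by (simp only:)
  then show ?case
    using contract.hyps contract.prems K_minor.contract[of u "insert z V" v B] by simp
qed

text \<open>Neighbours of \<open>v\<close> not shared with \<open>u\<close> pass to
  \<open>u\<close>. Lost are only the contracted edge and one edge per common neighbour, each
  counting as two arcs.\<close>

lemma card_arcs_ctr:
  assumes fin: "finite V" and A: "symp A" "irreflp A" and uv: "u \<in> V" "v \<in> V" "A u v"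
  shows "card (arcs V A) \<le>
    card (arcs (V - {v}) (ctr u v A)) + 2 * Suc (card (nbs V A u \<inter> nbs V A v))"
proof -
  define P where "P = nbs V A v - insert u (nbs V A u)"
  have uv': "u \<noteq> v" using uv A by (auto dest: irreflpD)
  have sym: "A x y \<longleftrightarrow> A y x" for x y using A by (auto dest: sympD)
  have irr: "\<not> A x x" for x using A by (auto dest: irreflpD)
  have "u \<in> nbs V A v" "u \<notin> nbs V A u" using uv sym irr by (auto simp: nbs_def)
  then have "nbs V A v = insert u (P \<union> (nbs V A u \<inter> nbs V A v))" by (auto simp: P_def)
  then have "card (nbs V A v) \<le> Suc (card (P \<union> (nbs V A u \<inter> nbs V A v)))"
    using fin finite_nbs by (metis P_def card_insert_if finite_Diff finite_Int finite_Un le_Suc_eq order_refl)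
  also have "\<dots> \<le> Suc (card P + card (nbs V A u \<inter> nbs V A v))"
    using card_Un_le by simp
  finally have P: "card (nbs V A v) \<le> card P + Suc (card (nbs V A u \<inter> nbs V A v))" by simp
  have finP: "finite P" "finite (nbs V A v)" using fin by (auto simp: P_def finite_nbs)
  have "arcs V A \<subseteq> arcs (V - {v}) A \<union> ({v} \<times> nbs V A v \<union> nbs V A v \<times> {v})"
    using sym by (auto simp: arcs_def nbs_def)
  then have "card (arcs V A) \<le> card (arcs (V - {v}) A \<union> ({v} \<times> nbs V A v \<union> nbs V A v \<times> {v}))"
    using fin finP by (intro card_mono) (auto simp: finite_arcs)
  also have "\<dots> \<le> card (arcs (V - {v}) A) + (card ({v} \<times> nbs V A v) + card (nbs V A v \<times> {v}))"
    by (meson card_Un_le order_trans add_left_mono)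
  also have "\<dots> = card (arcs (V - {v}) A) + 2 * card (nbs V A v)"
    by (simp add: card_cartesian_product)
  also have "\<dots> \<le> card (arcs (V - {v}) A) + 2 * card P + 2 * Suc (card (nbs V A u \<inter> nbs V A v))"
    using P by simp
  \<comment> \<open>Vertices of \<open>P\<close> are not adjacent to \<open>u\<close> in
    \<open>A\<close>, so these arcs are new; the contraction supplies them.\<close>
  also have "card (arcs (V - {v}) A) + 2 * card P =
      card (arcs (V - {v}) A \<union> ({u} \<times> P \<union> P \<times> {u}))"
  proof -
    have "({u} \<times> P) \<inter> (P \<times> {u}) = {}" by (auto simp: P_def)
    then have "card ({u} \<times> P \<union> P \<times> {u}) = 2 * card P"
      using finP by (simp add: card_Un_disjoint card_cartesian_product)
    moreover have "arcs (V - {v}) A \<inter> ({u} \<times> P \<union> P \<times> {u}) = {}"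
      using sym by (auto simp: arcs_def P_def nbs_def)
    ultimately show ?thesis using fin finP by (simp add: card_Un_disjoint finite_arcs)
  qed
  also have "\<dots> \<le> card (arcs (V - {v}) (ctr u v A))"
    using fin uv uv' irr sym
    by (intro card_mono finite_arcs) (auto simp: arcs_def P_def nbs_def ctr_def)
  finally show ?thesis by simp
qed

text \<open>
  Mader's argument: contract edges lying in few triangles, which preserves the density; once none
  is left, the neighbourhood of any nonisolated vertex is dense, and that vertex serves as an apex.
\<close>

lemma dense_imp_K_minor:
  assumes "finite V" "V \<noteq> {}" "symp A" "irreflp A" "2 ^ Suc t * card V \<le> card (arcs V A)"
  shows "K_minor t V A"
  using assms
proof (induction t arbitrary: V A)
  case 0
  have "K_minor 0 {} A" by (rule K_minor.complete) auto
  then show ?case using 0 K_minor_mono_vertices by blast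
next
  case (Suc t)
  note IH = Suc.IH
  show ?case using Suc.prems
  proof (induction "card V" arbitrary: V A rule: less_induct)
    case less
    note fin = less.prems(1) and A = less.prems(3,4)
    have sym: "A x y \<longleftrightarrow> A y x" for x y using A by (auto dest: sympD)
    have irr: "\<not> A x x" for x using A by (auto dest: irreflpD)
    show ?case
    proof (cases "\<exists>u v. u \<in> V \<and> v \<in> V \<and> A u v \<and> card (nbs V A u \<inter> nbs V A v) < 2 ^ Suc t")
      case True
      then obtain u v where uv: "u \<in> V" "v \<in> V" "A u v" "card (nbs V A u \<inter> nbs V A v) < 2 ^ Suc t"
        by blast
      have uv': "u \<noteq> v" using uv irr by auto
      have V: "card V = Suc (card (V - {v}))"
        using fin uv by (metis card_Suc_Diff1)
      have "card (arcs V A) \<le> card (arcs (V - {v}) (ctr u v A)) + 2 * 2 ^ Suc t"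
        using card_arcs_ctr[OF fin A uv(1-3)] uv(4) by simp
      \<comment> \<open>One vertex and at most \<open>2 ^ Suc (Suc t)\<close> arcs disappear, so the
        density hypothesis survives.\<close>
      then have "2 ^ Suc (Suc t) * card (V - {v}) \<le> card (arcs (V - {v}) (ctr u v A))"
        using less.prems(5) V by simp
      then have "K_minor (Suc t) (V - {v}) (ctr u v A)"
      proof (rule less.hyps[rotated -1])
        show "V - {v} \<noteq> {}" using uv uv' by blast
      qed (use V fin A in \<open>simp_all add: symp_ctr irreflp_ctr\<close>)
      then show ?thesis using uv uv' K_minor.contract by metis
    next
      case False
      have "arcs V A \<noteq> {}"
        using less.prems by (auto simp: card_gt_0_iff)
      then obtain z y where z: "z \<in> V" "y \<in> V" "A z y" by (auto simp: arcs_def)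
      define N where "N = nbs V A z"
      have N: "finite N" "N \<noteq> {}" "z \<notin> N" "N \<subseteq> V"
        using fin z irr by (auto simp: N_def nbs_def)
      \<comment> \<open>Every edge at \<open>z\<close> lies in at least \<open>2 ^ Suc t\<close>
        triangles, whose third vertices belong to \<open>N\<close>; the minimum degree inside
        \<open>N\<close> thus gives the density required for \<open>t\<close>.\<close>
      have "2 ^ Suc t \<le> card (nbs N A x)" if "x \<in> N" for x
      proof -
        have "nbs N A x = nbs V A z \<inter> nbs V A x" by (auto simp: N_def nbs_def)
        moreover have "x \<in> V" "A z x" using that by (auto simp: N_def nbs_def)
        ultimately show ?thesis using False z by (metis linorder_not_le)
      qed
      then have "(\<Sum>x\<in>N. 2 ^ Suc t) \<le> card (arcs N A)"
        unfolding card_arcs[OF N(1)] by (intro sum_mono)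
      then have "K_minor t N A" using IH[OF N(1,2) A] by (simp add: mult.commute)
      then have "K_minor (Suc t) (insert z N) A"
        using N sym by (intro K_minor_apex[of t N A]) (auto simp: N_def nbs_def)
      then show ?thesis using K_minor_mono_vertices[of V "insert z N"] N z fin by simp
    qed
  qed
qed

subsection \<open>Sparsity and mergeable pairs\<close>

text \<open>The empty set counts as a clique, whence the summand 1 in
  \<open>card_cliques_le\<close>.\<close>

definition cliques :: "'a set \<Rightarrow> ('a \<Rightarrow> 'a \<Rightarrow> bool) \<Rightarrow> 'a set set" where
  "cliques V A = {S. S \<subseteq> V \<and> (\<forall>x\<in>S. \<forall>y\<in>S. x \<noteq> y \<longrightarrow> A x y)}"

lemma finite_cliques: "finite V \<Longrightarrow> finite (cliques V A)"
  by (rule finite_subset[of _ "Pow V"]) (auto simp: cliques_def)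

lemma card_arcs_less:
  assumes "finite V" "V \<noteq> {}" "symp A" "irreflp A" "\<not> K_minor t V A"
  shows "card (arcs V A) < 2 ^ Suc t * card V"
  using dense_imp_K_minor[of V A t] assms by linarith

lemma ex_low_degree:
  assumes "finite V" "V \<noteq> {}" "symp A" "irreflp A" "\<not> K_minor t V A"
  shows "\<exists>v\<in>V. card (nbs V A v) < 2 ^ Suc t"
proof (rule ccontr)
  assume "\<not> ?thesis"
  then have "(\<Sum>v\<in>V. 2 ^ Suc t) \<le> card (arcs V A)"
    unfolding card_arcs[OF assms(1)] by (intro sum_mono) (simp add: not_less)
  then show False using card_arcs_less[OF assms] by (simp add: mult.commute)
qed

text \<open>A vertex of degree below \<open>2 ^ Suc t\<close> is peeled off: a clique containing it
  is determined by a subset of its neighbourhood, so each vertex costs at most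
  \<open>2 ^ 2 ^ Suc t\<close> cliques.\<close>

lemma card_cliques_le:
  assumes "finite V" "symp A" "irreflp A" "\<not> K_minor t V A"
  shows "card (cliques V A) \<le> 2 ^ 2 ^ Suc t * card V + 1"
  using assms
proof (induction "card V" arbitrary: V)
  case 0
  then have "cliques V A = {{}}" by (auto simp: cliques_def)
  then show ?case by simp
next
  case (Suc n)
  have "V \<noteq> {}" using Suc.hyps(2) by auto
  then obtain v where v: "v \<in> V" "card (nbs V A v) < 2 ^ Suc t"
    using ex_low_degree[of V A t] Suc.prems by blast
  have n: "n = card (V - {v})" using Suc.hyps(2) Suc.prems(1) v(1) by simp
  have "\<not> K_minor t (V - {v}) A" using K_minor.delete[of v V t A] v Suc.prems by blast
  then have IH: "card (cliques (V - {v}) A) \<le> 2 ^ 2 ^ Suc t * n + 1"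
    using Suc.hyps(1)[OF n] Suc.prems n by simp
  have "S \<in> cliques (V - {v}) A \<union> insert v ` Pow (nbs V A v)" if S: "S \<in> cliques V A" for S
  proof (cases "v \<in> S")
    case True
    then have "S - {v} \<in> Pow (nbs V A v)" "S = insert v (S - {v})"
      using S by (auto simp: cliques_def nbs_def)
    then show ?thesis by blast
  qed (use S in \<open>auto simp: cliques_def\<close>)
  then have "cliques V A \<subseteq> cliques (V - {v}) A \<union> insert v ` Pow (nbs V A v)" by blast
  then have "card (cliques V A) \<le> card (cliques (V - {v}) A \<union> insert v ` Pow (nbs V A v))"
    using Suc.prems(1) by (intro card_mono) (auto simp: finite_cliques finite_nbs)
  also have "\<dots> \<le> card (cliques (V - {v}) A) + card (insert v ` Pow (nbs V A v))"
    by (rule card_Un_le)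
  also have "card (insert v ` Pow (nbs V A v)) \<le> card (Pow (nbs V A v))"
    using Suc.prems(1) by (intro card_image_le) (simp add: finite_nbs)
  also have "\<dots> = 2 ^ card (nbs V A v)"
    using Suc.prems(1) by (simp add: card_Pow finite_nbs)
  also have "(2::nat) ^ card (nbs V A v) \<le> 2 ^ 2 ^ Suc t"
    using v(2) by (intro power_increasing) auto
  finally show ?case using IH Suc.hyps(2)[symmetric] by simp
qed

text \<open>
  As long as some vertex of the independent side sees two nonadjacent vertices of H, contracting it
  into one of them creates a new edge inside H; the minor on H is sparse, so this happens rarely.
  Afterwards every remaining neighbourhood is a clique of H.
\<close>

lemma card_distinct_neighbourhoods_le:
  assumes "finite H" "finite L" "H \<inter> L = {}" "symp A" "irreflp A" "\<not> K_minor t (H \<union> L) A"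
    and "\<And>l x. \<lbrakk>l \<in> L; x \<in> L\<rbrakk> \<Longrightarrow> \<not> A l x" and "inj_on (nbs H A) L"
  shows "2 * card L + card (arcs H A) \<le> 2 ^ Suc t * card H + 2 * (2 ^ 2 ^ Suc t * card H + 1)"
  using assms
proof (induction "card L" arbitrary: L A rule: less_induct)
  case less
  note fin = less.prems(1,2) and disj = less.prems(3) and A = less.prems(4,5)
  have sym: "A x y \<longleftrightarrow> A y x" for x y using A by (auto dest: sympD)
  have irr: "\<not> A x x" for x using A by (auto dest: irreflpD)
  show ?case
  proof (cases "nbs H A ` L \<subseteq> cliques H A")
    case True
    have nH: "\<not> K_minor t H A"
      using less.prems(6) K_minor_mono_vertices[of "H \<union> L" H t A] fin by blast
    have "card L = card (nbs H A ` L)" using less.prems(8) by (simp add: card_image)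
    also have "\<dots> \<le> card (cliques H A)" using True fin by (intro card_mono) (auto simp: finite_cliques)
    also have "\<dots> \<le> 2 ^ 2 ^ Suc t * card H + 1" by (rule card_cliques_le[OF fin(1) A nH])
    finally have L: "card L \<le> 2 ^ 2 ^ Suc t * card H + 1" .
    have arcs: "card (arcs H A) \<le> 2 ^ Suc t * card H"
    proof (cases "H = {}")
      case True
      then show ?thesis by (simp add: arcs_def)
    qed (use card_arcs_less[OF fin(1) _ A nH] in simp)
    show ?thesis by (subst add.commute) (intro add_mono mult_le_mono2 L arcs)
  next
    case False
    then obtain l a b where l: "l \<in> L" and ab: "a \<in> H" "b \<in> H" "A l a" "A l b" "a \<noteq> b" "\<not> A a b"
      by (auto simp: cliques_def nbs_def)
    define B where "B = ctr a l A"
    have B: "symp B" "irreflp B" using A by (simp_all add: B_def symp_ctr irreflp_ctr)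
    have cL: "card L = Suc (card (L - {l}))" using fin l by (metis card_Suc_Diff1)
    have "a \<noteq> l" using ab l disj by blast
    then have "\<not> K_minor t ((H \<union> L) - {l}) B"
      using less.prems(6) K_minor.contract[of a "H \<union> L" l A t] ab l sym by (auto simp: B_def)
    moreover have "(H \<union> L) - {l} = H \<union> (L - {l})" using disj l by auto
    ultimately have nB: "\<not> K_minor t (H \<union> (L - {l})) B" by simp
    \<comment> \<open>Nothing in \<open>L\<close> is adjacent to \<open>l\<close>, so contracting
      \<open>l\<close> into \<open>a\<close> creates edges only inside \<open>H\<close>: the rest of
      \<open>L\<close> stays independent and keeps its neighbourhoods.\<close>
    have "\<not> B x y" if "x \<in> L - {l}" "y \<in> L - {l}" for x y
      using that less.prems(7) ab disj l by (auto simp: B_def ctr_def)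
    moreover have nbs: "nbs H B x = nbs H A x" if "x \<in> L - {l}" for x
      using that less.prems(7) ab disj l by (auto simp: B_def ctr_def nbs_def)
    then have "inj_on (nbs H B) (L - {l})"
      using less.prems(8) by (auto simp: inj_on_def)
    ultimately have "2 * card (L - {l}) + card (arcs H B) \<le>
        2 ^ Suc t * card H + 2 * (2 ^ 2 ^ Suc t * card H + 1)"
      using cL fin disj B nB by (intro less.hyps) auto
    \<comment> \<open>The new edge between \<open>a\<close> and \<open>b\<close> yields two arcs,
      which balances the loss of \<open>l\<close> in the term \<open>2 * card L\<close>.\<close>
    moreover have "card (arcs H A) + 2 \<le> card (arcs H B)"
    proof -
      have "card (arcs H A) + 2 = card (arcs H A \<union> {(a, b), (b, a)})"
        using ab sym fin by (subst card_Un_disjoint) (auto simp: arcs_def finite_arcs[unfolded arcs_def])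
      also have "\<dots> \<le> card (arcs H B)"
        using ab sym irr fin by (intro card_mono finite_arcs) (auto simp: arcs_def B_def ctr_def)
      finally show ?thesis .
    qed
    ultimately show ?thesis using cL by linarith
  qed
qed

text \<open>With \<open>d = 2 ^ Suc t\<close> from the arc bound and
  \<open>e = 2 ^ 2 ^ Suc t\<close> from the clique count, this is
  \<open>2 * d * (d + e + 1)\<close>; the factor 2 makes the degree sum of the high-degree vertices
  too large for a sparse graph.\<close>

definition low_bound :: "nat \<Rightarrow> nat" where
  "low_bound t = 2 * 2 ^ Suc t * (2 ^ Suc t + 2 ^ 2 ^ Suc t + 1)"

text \<open>
  Otherwise the low-degree vertices are independent with distinct neighbourhoods among the few
  high-degree vertices, so there are too few of them.
\<close>

lemma ex_contractible_pair:
  assumes fin: "finite V" and V: "1 < card V" and A: "symp A" "irreflp A" and free: "\<not> K_minor t V A"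
  shows "\<exists>u v. u \<in> V \<and> v \<in> V \<and> u \<noteq> v \<and> card (nbs V A u) \<le> low_bound t \<and>
    card (nbs V A v) \<le> low_bound t \<and> (A u v \<or> nbs V A u = nbs V A v)"
proof (rule ccontr)
  assume neg: "\<not> ?thesis"
  define L where "L = {x \<in> V. card (nbs V A x) \<le> low_bound t}"
  define H where "H = V - L"
  define d :: nat where "d = 2 ^ Suc t"
  define e :: nat where "e = 2 ^ 2 ^ Suc t"
  have irr: "\<not> A x x" for x using A by (auto dest: irreflpD)
  have VHL: "V = H \<union> L" "H \<inter> L = {}" "finite H" "finite L" using fin by (auto simp: H_def L_def)
  have indep: "\<not> A x y" if "x \<in> L" "y \<in> L" for x y
    using neg that irr by (cases "x = y") (auto simp: L_def)
  have nbs: "nbs V A x = nbs H A x" if "x \<in> L" for x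
    using indep[OF that] VHL(1) by (auto simp: nbs_def)
  have "inj_on (nbs H A) L"
  proof (rule inj_onI)
    fix x y assume xy: "x \<in> L" "y \<in> L" "nbs H A x = nbs H A y"
    then have "nbs V A x = nbs V A y" using nbs by simp
    then show "x = y" using neg xy(1,2) unfolding L_def by blast
  qed
  then have "2 * card L + card (arcs H A) \<le> d * card H + 2 * (e * card H + 1)"
    unfolding d_def e_def
    using VHL free indep A by (intro card_distinct_neighbourhoods_le) auto
  \<comment> \<open>The arcs inside \<open>H\<close> are dropped and \<open>d / 2\<close> is rounded
    up to \<open>d\<close>.\<close>
  then have L: "card L \<le> (d + e) * card H + 1" by (simp add: algebra_simps)
  have VH: "card V = card H + card L" using VHL by (simp add: card_Un_disjoint)
  have "(\<Sum>x\<in>H. low_bound t) \<le> (\<Sum>x\<in>H. card (nbs V A x))"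
    by (intro sum_mono) (auto simp: H_def L_def)
  also have "\<dots> \<le> card (arcs V A)"
    unfolding card_arcs[OF fin] using fin by (intro sum_mono2) (auto simp: H_def)
  also have "\<dots> < d * card V"
    unfolding d_def using card_arcs_less[OF fin _ A free] V by force
  finally have "d * (2 * ((d + e + 1) * card H)) < d * card V"
    by (simp add: low_bound_def d_def e_def algebra_simps)
  then have "2 * ((d + e + 1) * card H) < card V" by (simp only: mult_less_cancel1)
  \<comment> \<open>\<open>V\<close> has at most \<open>(d + e + 1) * card H + 1\<close> elements.
    This forces \<open>H\<close> to be empty, and then \<open>V\<close> has at most one
    element.\<close>
  then have "2 * ((d + e + 1) * card H) < (d + e + 1) * card H + 1"
    using L VH by (simp add: algebra_simps)
  then have "(d + e + 1) * card H = 0" by linarith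
  then have "card H = 0" by simp
  then show False using L VH V by simp
qed

subsection \<open>Contraction sequences from partitions\<close>

definition joined :: "'a set \<Rightarrow> ('a \<Rightarrow> 'a \<Rightarrow> bool) \<Rightarrow> ('a \<Rightarrow> 'b) \<Rightarrow> 'b \<Rightarrow> 'b \<Rightarrow> bool" where
  "joined V A h x y \<longleftrightarrow> (\<exists>a\<in>V. \<exists>b\<in>V. h a = x \<and> h b = y \<and> A a b)"

definition fully_joined :: "'a set \<Rightarrow> ('a \<Rightarrow> 'a \<Rightarrow> bool) \<Rightarrow> ('a \<Rightarrow> 'b) \<Rightarrow> 'b \<Rightarrow> 'b \<Rightarrow> bool" where
  "fully_joined V A h x y \<longleftrightarrow> (\<forall>a\<in>V. \<forall>b\<in>V. h a = x \<longrightarrow> h b = y \<longrightarrow> A a b)"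

text \<open>The result of contracting every fibre of \<open>h\<close> to one vertex: all that
  contraction remembers of two fibres is whether they are completely joined, not joined at all, or
  neither.\<close>

definition quot_trigraph :: "'a set \<Rightarrow> ('a \<Rightarrow> 'a \<Rightarrow> bool) \<Rightarrow> ('a \<Rightarrow> 'b) \<Rightarrow> 'b trigraph" where
  "quot_trigraph V A h = (h ` V, edges_of (h ` V) (fully_joined V A h),
    edges_of (h ` V) (\<lambda>x y. joined V A h x y \<and> \<not> fully_joined V A h x y))"

definition merge :: "'b \<Rightarrow> 'b \<Rightarrow> ('a \<Rightarrow> 'b) \<Rightarrow> 'a \<Rightarrow> 'b" where
  "merge u v h a = (if h a = v then u else h a)"

text \<open>Refinement of partitions, with \<open>f\<close> the finer one. The label types may
  differ, since \<open>refine\<close> uses pairs as labels.\<close>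

definition ker_le :: "'a set \<Rightarrow> ('a \<Rightarrow> 'b) \<Rightarrow> ('a \<Rightarrow> 'c) \<Rightarrow> bool" where
  "ker_le V f g \<longleftrightarrow> (\<forall>a\<in>V. \<forall>b\<in>V. f a = f b \<longrightarrow> g a = g b)"

lemma symp_joined: "symp A \<Longrightarrow> symp (joined V A h)"
  unfolding symp_def joined_def by blast

lemma symp_fully_joined: "symp A \<Longrightarrow> symp (fully_joined V A h)"
  unfolding symp_def fully_joined_def by blast

lemma fully_joined_imp_joined:
  "\<lbrakk>x \<in> h ` V; y \<in> h ` V; fully_joined V A h x y\<rbrakk> \<Longrightarrow> joined V A h x y"
  unfolding joined_def fully_joined_def by blast

lemma image_merge: "\<lbrakk>u \<in> h ` V; u \<noteq> v\<rbrakk> \<Longrightarrow> merge u v h ` V = h ` V - {v}"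
  by (force simp: merge_def)

lemma joined_merge:
  assumes "u \<noteq> v" "x \<noteq> v" "y \<noteq> v" "x \<noteq> y"
  shows "joined V A (merge u v h) x y \<longleftrightarrow>
    joined V A h x y \<or> x = u \<and> joined V A h v y \<or> y = u \<and> joined V A h x v"
  using assms unfolding joined_def merge_def by (auto split: if_splits)

text \<open>Through the complement of \<open>A\<close>, the merging rule for
  \<open>fully_joined\<close> becomes the dual of the one for \<open>joined\<close>.\<close>

lemma fully_joined_iff: "fully_joined V A h x y \<longleftrightarrow> \<not> joined V (\<lambda>a b. \<not> A a b) h x y"
  unfolding joined_def fully_joined_def by blast

lemma fully_joined_merge:
  assumes "u \<noteq> v" "x \<noteq> v" "y \<noteq> v" "x \<noteq> y"
  shows "fully_joined V A (merge u v h) x y \<longleftrightarrow> fully_joined V A h x y \<and>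
    (x = u \<longrightarrow> fully_joined V A h v y) \<and> (y = u \<longrightarrow> fully_joined V A h x v)"
  using joined_merge[OF assms, of V "\<lambda>a b. \<not> A a b" h] unfolding fully_joined_iff by blast

text \<open>Common form of the black and the red edge set of \<open>contract u v u\<close>: old
  edges away from the pair, and edges at \<open>u\<close> governed by \<open>P\<close>.\<close>

lemma edges_of_merge:
  assumes B: "symp B" "symp B'" and uv: "u \<in> X" "v \<in> X" "u \<noteq> v"
    and off: "\<And>x y. \<lbrakk>x \<in> X - {u, v}; y \<in> X - {u, v}; x \<noteq> y\<rbrakk> \<Longrightarrow> B' x y \<longleftrightarrow> B x y"
    and at: "\<And>x. x \<in> X - {u, v} \<Longrightarrow> B' u x \<longleftrightarrow> P x"
  shows "edges_of (X - {v}) B' =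
    edges_of X B \<inter> nsets (X - {u, v}) 2 \<union> {{u, x} | x. x \<in> X - {u, v} \<and> P x}"
    (is "?L = ?R \<union> ?S")
proof
  show "?L \<subseteq> ?R \<union> ?S"
  proof
    fix e assume "e \<in> ?L"
    then obtain x y where e: "e = {x, y}" "x \<in> X - {v}" "y \<in> X - {v}" "x \<noteq> y" "B' x y"
      by (auto simp: edges_of_def)
    consider "x = u" | "y = u" | "x \<noteq> u" "y \<noteq> u" by blast
    then show "e \<in> ?R \<union> ?S"
    proof cases
      case 1
      then show ?thesis using at[of y] e by blast
    next
      case 2
      then have "P x" using at[of x] e B by (auto dest: sympD)
      then show ?thesis using 2 e by (auto simp: insert_commute)
    next
      case 3
      then have "e \<in> ?R" using e off[of x y] B by (auto simp: in_edges_of)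
      then show ?thesis by blast
    qed
  qed
next
  have "?R \<subseteq> ?L"
  proof
    fix e assume "e \<in> ?R"
    then obtain x y where "e = {x, y}" "x \<in> X - {u, v}" "y \<in> X - {u, v}" "x \<noteq> y" "B x y"
      by (auto simp: edges_of_def)
    then show "e \<in> ?L" using off[of x y] B by (auto simp: in_edges_of)
  qed
  moreover have "?S \<subseteq> ?L" using at uv B by (auto simp: in_edges_of)
  ultimately show "?R \<union> ?S \<subseteq> ?L" by blast
qed

text \<open>The merged fibre is joined to another iff one of the two was, and fully joined iff both
  were; this is the rule for red and black edges. The new vertex reuses the name
  \<open>u\<close>.\<close>

lemma contraction_step_merge:
  assumes A: "symp A" and uv: "u \<in> h ` V" "v \<in> h ` V" "u \<noteq> v"
  shows "contraction_step (quot_trigraph V A h) (quot_trigraph V A (merge u v h))"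
proof -
  define X where "X = h ` V"
  define F where "F = fully_joined V A h"
  define R where "R = (\<lambda>x y. joined V A h x y \<and> \<not> fully_joined V A h x y)"
  have sym: "symp F" "symp R"
    using symp_joined[OF A, of V h] symp_fully_joined[OF A, of V h]
    by (auto simp: F_def R_def symp_def)
  \<comment> \<open>Fibres of attained labels are nonempty, so fully joined implies joined, and
    joined means black or red.\<close>
  have imp: "joined V A h x y \<longleftrightarrow> F x y \<or> R x y" if "x \<in> X" "y \<in> X" for x y
    using that fully_joined_imp_joined[of x h V y A] by (auto simp: F_def R_def X_def)
  have quot: "quot_trigraph V A h = (X, edges_of X F, edges_of X R)"
    by (simp add: quot_trigraph_def X_def F_def R_def)
  define h' where "h' = merge u v h"
  have X': "h' ` V = X - {v}" using uv by (simp add: h'_def X_def image_merge)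
  have "edges_of (h' ` V) (fully_joined V A h') = edges_of X F \<inter> nsets (X - {u, v}) 2 \<union>
      {{u, x} | x. x \<in> X - {u, v} \<and> {u, x} \<in> edges_of X F \<and> {v, x} \<in> edges_of X F}"
    unfolding X'
    by (rule edges_of_merge)
      (use uv A sym in \<open>auto simp: X_def[symmetric] h'_def fully_joined_merge symp_fully_joined
        in_edges_of F_def[symmetric]\<close>)
  moreover have "edges_of (h' ` V) (\<lambda>x y. joined V A h' x y \<and> \<not> fully_joined V A h' x y) =
      edges_of X R \<inter> nsets (X - {u, v}) 2 \<union>
      {{u, x} | x. x \<in> X - {u, v} \<and> (\<not> ({u, x} \<in> edges_of X F \<and> {v, x} \<in> edges_of X F)
        \<and> \<not> ({u, x} \<notin> edges_of X F \<union> edges_of X R \<and> {v, x} \<notin> edges_of X F \<union> edges_of X R))}"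
    unfolding X'
  proof (rule edges_of_merge)
    show "symp (\<lambda>x y. joined V A h' x y \<and> \<not> fully_joined V A h' x y)"
      using symp_joined[OF A, of V h'] symp_fully_joined[OF A, of V h'] by (auto simp: symp_def)
  next
    fix x assume x: "x \<in> X - {u, v}"
    have "joined V A h' u x \<longleftrightarrow> joined V A h u x \<or> joined V A h v x"
      using x uv A by (auto simp: h'_def joined_merge)
    moreover have "fully_joined V A h' u x \<longleftrightarrow> F u x \<and> F v x"
      using x uv A by (auto simp: h'_def fully_joined_merge F_def)
    moreover have "{w, x} \<in> edges_of X F \<longleftrightarrow> F w x" "{w, x} \<in> edges_of X R \<longleftrightarrow> R w x"
        "joined V A h w x \<longleftrightarrow> F w x \<or> R w x" if "w \<in> {u, v}" for w
      using that x uv imp[of w x] sym by (auto simp: in_edges_of X_def)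
    ultimately show "joined V A h' u x \<and> \<not> fully_joined V A h' u x \<longleftrightarrow>
      (\<not> ({u, x} \<in> edges_of X F \<and> {v, x} \<in> edges_of X F)
        \<and> \<not> ({u, x} \<notin> edges_of X F \<union> edges_of X R \<and> {v, x} \<notin> edges_of X F \<union> edges_of X R))"
      by auto
  qed (use uv A sym in \<open>auto simp: X_def h'_def fully_joined_merge joined_merge R_def\<close>)
  moreover have "insert u (X - {u, v}) = h' ` V" using X' uv by (auto simp: X_def)
  ultimately have eq: "quot_trigraph V A h' = contract u v u (quot_trigraph V A h)"
    by (simp only: quot contract.simps Let_def) (simp only: quot_trigraph_def)
  have tri: "tri_vertices (quot_trigraph V A h) = h ` V" by (simp add: quot_trigraph_def)
  show ?thesis
    unfolding contraction_step_def tri h'_def[symmetric] eq using uv by blast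
qed

text \<open>Only the target is bounded; the first trigraph of a sequence gets its own assumption in
  \<open>twin_width_le\<close>.\<close>

definition bounded_step :: "nat \<Rightarrow> 'a trigraph \<Rightarrow> 'a trigraph \<Rightarrow> bool" where
  "bounded_step d T T' \<longleftrightarrow> contraction_step T T' \<and> max_red_degree_le d T'"

text \<open>
  Labels of parts are names of vertices, so only the kernel of the final labelling is determined.
\<close>

lemma bounded_steps_coarsen:
  fixes f :: "'a \<Rightarrow> 'b" and g :: "'a \<Rightarrow> 'c"
  assumes "finite V" "symp A" "ker_le V f g"
    and "\<And>h :: 'a \<Rightarrow> 'b. \<lbrakk>ker_le V f h; ker_le V h g\<rbrakk> \<Longrightarrow> max_red_degree_le d (quot_trigraph V A h)"
  shows "\<exists>f' :: 'a \<Rightarrow> 'b. ker_le V f' g \<and> ker_le V g f' \<and>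
    (bounded_step d)\<^sup>*\<^sup>* (quot_trigraph V A f) (quot_trigraph V A f')"
  using assms
proof (induction "card (f ` V)" arbitrary: f rule: less_induct)
  case less
  show ?case
  proof (cases "ker_le V g f")
    case True
    then show ?thesis using less.prems by blast
  next
    case False
    then obtain a b where ab: "a \<in> V" "b \<in> V" "g a = g b" "f a \<noteq> f b"
      by (auto simp: ker_le_def)
    \<comment> \<open>\<open>g\<close> does not separate \<open>a\<close> from \<open>b\<close>, so
      uniting their parts stays between \<open>f\<close> and \<open>g\<close>.\<close>
    define f1 where "f1 = merge (f a) (f b) f"
    have ff1: "ker_le V f f1" by (auto simp: f1_def ker_le_def merge_def)
    have f1g: "ker_le V f1 g"
      using less.prems(3) ab unfolding f1_def ker_le_def merge_def by metis
    have "f1 ` V = f ` V - {f b}" unfolding f1_def using ab by (intro image_merge) auto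
    then have "card (f1 ` V) < card (f ` V)"
      using ab less.prems(1) by (simp only: card_Diff1_less finite_imageI imageI)
    moreover have red: "max_red_degree_le d (quot_trigraph V A h)"
      if "ker_le V f1 h" "ker_le V h g" for h :: "'a \<Rightarrow> 'b"
      using less.prems(4)[of h] that ff1 unfolding ker_le_def by metis
    ultimately obtain f' :: "'a \<Rightarrow> 'b" where f': "ker_le V f' g" "ker_le V g f'"
      "(bounded_step d)\<^sup>*\<^sup>* (quot_trigraph V A f1) (quot_trigraph V A f')"
      using less.hyps[of f1] less.prems(1,2) f1g by blast
    have "max_red_degree_le d (quot_trigraph V A f1)"
      by (rule red[OF _ f1g]) (simp add: ker_le_def)
    moreover have "contraction_step (quot_trigraph V A f) (quot_trigraph V A f1)"
      unfolding f1_def by (rule contraction_step_merge) (use less.prems(2) ab in simp_all)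
    ultimately have "bounded_step d (quot_trigraph V A f) (quot_trigraph V A f1)"
      by (simp add: bounded_step_def)
    then have "(bounded_step d)\<^sup>*\<^sup>* (quot_trigraph V A f) (quot_trigraph V A f')"
      using f'(3) by (rule converse_rtranclp_into_rtranclp)
    then show ?thesis using f'(1,2) by (intro exI[of _ f'] conjI)
  qed
qed

lemma twin_width_le:
  assumes "(bounded_step d)\<^sup>*\<^sup>* (trigraph_of G) T" "max_red_degree_le d (trigraph_of G)"
    "card (tri_vertices T) = 1"
  shows "twin_width G \<le> d"
proof -
  have "\<exists>Ts. Ts \<noteq> [] \<and> hd Ts = S \<and> last Ts = T \<and> successively contraction_step Ts \<and>
      (\<forall>T \<in> set Ts. max_red_degree_le d T)"
    if "(bounded_step d)\<^sup>*\<^sup>* S T" "max_red_degree_le d S" for S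
    using that
  proof (induction rule: converse_rtranclp_induct)
    case base
    then show ?case by (intro exI[of _ "[T]"]) simp
  next
    case (step S S')
    then obtain Ts where "Ts \<noteq> []" "hd Ts = S'" "last Ts = T" "successively contraction_step Ts"
      "\<forall>T \<in> set Ts. max_red_degree_le d T" by (auto simp: bounded_step_def)
    then show ?case
      using step by (intro exI[of _ "S # Ts"]) (auto simp: successively_Cons bounded_step_def)
  qed
  from this[OF assms(1,2)] show ?thesis
    unfolding twin_width_def contraction_sequence_def using assms(3) by (intro Least_le) auto
qed

subsection \<open>Refined quotients\<close>

definition singles :: "'a set \<Rightarrow> ('a \<Rightarrow> 'b) \<Rightarrow> 'a set" where
  "singles V q = {s \<in> V. \<forall>b\<in>V. q b = q s \<longrightarrow> b = s}"

definition refine :: "'a set \<Rightarrow> ('a \<Rightarrow> 'a \<Rightarrow> bool) \<Rightarrow> ('a \<Rightarrow> 'b) \<Rightarrow> 'a \<Rightarrow> 'b \<times> 'a set" where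
  "refine V A q a = (q a, nbs (singles V q) A a)"

definition quot_adj :: "'a set \<Rightarrow> ('a \<Rightarrow> 'a \<Rightarrow> bool) \<Rightarrow> ('a \<Rightarrow> 'b) \<Rightarrow> 'b \<Rightarrow> 'b \<Rightarrow> bool" where
  "quot_adj V A q x y \<longleftrightarrow> x \<noteq> y \<and> joined V A q x y"

definition tame :: "nat \<Rightarrow> 'a set \<Rightarrow> ('a \<Rightarrow> 'a \<Rightarrow> bool) \<Rightarrow> ('a \<Rightarrow> 'b) \<Rightarrow> bool" where
  "tame d V A q \<longleftrightarrow>
    (\<forall>x \<in> q ` V - q ` singles V q. card (nbs (q ` V) (quot_adj V A q) x) \<le> d)"

lemma symp_quot_adj: "symp A \<Longrightarrow> symp (quot_adj V A q)"
  using symp_joined[of A V q] by (auto simp: symp_def quot_adj_def)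

lemma irreflp_quot_adj: "irreflp (quot_adj V A q)"
  by (auto simp: irreflp_def quot_adj_def)

lemma quot_adj_merge:
  assumes "u \<noteq> v" "x \<noteq> v" "y \<noteq> v"
  shows "quot_adj V A (merge u v q) x y \<longleftrightarrow> x \<noteq> y \<and>
    (quot_adj V A q x y \<or> x = u \<and> quot_adj V A q v y \<or> y = u \<and> quot_adj V A q x v)"
  using assms by (cases "x = y") (auto simp: quot_adj_def joined_merge)

lemma singlesD: "\<lbrakk>s \<in> singles V q; b \<in> V; q b = q s\<rbrakk> \<Longrightarrow> b = s"
  unfolding singles_def by blast

lemma singles_merge: "singles V (merge u v q) \<subseteq> singles V q"
proof
  fix s assume s: "s \<in> singles V (merge u v q)"
  have "b = s" if "b \<in> V" "q b = q s" for b
    using singlesD[OF s that(1)] that(2) unfolding merge_def by simp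
  then show "s \<in> singles V q" using s unfolding singles_def by blast
qed

text \<open>Merging creates no singleton fibre, so the neighbourhoods that split the fibres are
  taken in a subset of the former singletons.\<close>

lemma ker_le_refine_merge: "ker_le V (refine V A q) (refine V A (merge u v q))"
  using singles_merge[of V u v q] by (auto simp: ker_le_def refine_def nbs_def merge_def)

text \<open>The vertices of a nonsingleton fibre together see at most \<open>d\<close> singletons,
  as these are distinct neighbours in the quotient. So at most \<open>2 ^ d\<close> neighbourhoods
  among the singletons occur, and each determines \<open>h\<close> on the fibre.\<close>

lemma card_image_fibre_le:
  assumes fin: "finite V" and q: "tame d V A q" and h: "ker_le V (refine V A q) h"
  shows "card (h ` {a \<in> V. q a = x}) \<le> 2 ^ d"
proof (cases "x \<in> q ` singles V q")
  case True
  then obtain s where "s \<in> singles V q" "x = q s" by blast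
  then have "h ` {a \<in> V. q a = x} \<subseteq> {h s}" by (auto simp: singles_def)
  then have "card (h ` {a \<in> V. q a = x}) \<le> card {h s}" by (intro card_mono) auto
  also have "\<dots> \<le> 2 ^ d" by simp
  finally show ?thesis .
next
  case no_single: False
  show ?thesis
  proof (cases "x \<in> q ` V")
    case False
    then have "{a \<in> V. q a = x} = {}" by blast
    then show ?thesis by (simp only: image_empty card.empty)
  next
    case True
    define F where "F = {a \<in> V. q a = x}"
    define S where "S = {s \<in> singles V q. \<exists>a\<in>F. A a s}"
    have finS: "finite S" using fin by (auto simp: S_def singles_def)
    have "inj_on q S" by (auto simp: inj_on_def S_def singles_def)
    moreover have "q ` S \<subseteq> nbs (q ` V) (quot_adj V A q) x"
      using no_single
      by (auto simp: S_def F_def nbs_def quot_adj_def joined_def singles_def)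
    moreover have "finite (nbs (q ` V) (quot_adj V A q) x)" using fin by (simp add: finite_nbs)
    ultimately have "card S \<le> card (nbs (q ` V) (quot_adj V A q) x)"
      by (metis card_image card_mono)
    also have "\<dots> \<le> d" using q True no_single by (auto simp: tame_def)
    finally have S: "card S \<le> d" .
    have nbs: "nbs (singles V q) A a = nbs S A a" if "a \<in> F" for a
      using that by (auto simp: nbs_def S_def)
    have h_eq: "h a = h b" if "a \<in> F" "b \<in> F" "nbs S A a = nbs S A b" for a b
      using h that nbs[OF that(1)] nbs[OF that(2)]
      by (auto simp: ker_le_def refine_def F_def)
    \<comment> \<open>On \<open>F\<close>, \<open>h\<close> factors through the neighbourhood in
      \<open>S\<close>; choice picks a representative for each one.\<close>
    have "h ` F \<subseteq> (\<lambda>N. h (SOME a. a \<in> F \<and> nbs S A a = N)) ` Pow S"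
    proof
      fix y assume "y \<in> h ` F"
      then obtain a where a: "a \<in> F" "y = h a" by blast
      define b where "b = (SOME b. b \<in> F \<and> nbs S A b = nbs S A a)"
      have "b \<in> F \<and> nbs S A b = nbs S A a"
        unfolding b_def by (rule someI[of _ a]) (use a in simp)
      then have "y = h b" using h_eq[of a b] a by (simp only:)
      moreover have "nbs S A a \<in> Pow S" by (auto simp: nbs_def)
      ultimately show "y \<in> (\<lambda>N. h (SOME a. a \<in> F \<and> nbs S A a = N)) ` Pow S"
        unfolding b_def by blast
    qed
    then have "card (h ` F) \<le> card (Pow S)"
      using finS by (meson card_image_le card_mono finite_Pow_iff finite_imageI order_trans)
    also have "\<dots> \<le> 2 ^ d" using S finS by (simp add: card_Pow)
    finally show ?thesis by (simp add: F_def)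
  qed
qed

text \<open>
  Vertices with the same label agree on every singleton fibre of the coarser partition, so red edges
  only join nonsingleton fibres that coincide or are adjacent.
\<close>

lemma max_red_degree_between:
  assumes fin: "finite V" and A: "symp A"
    and q: "tame d V A q" "tame d V A (merge u v q)"
    and h: "ker_le V (refine V A q) h" "ker_le V h (refine V A (merge u v q))"
  shows "max_red_degree_le (Suc d * (2 * 2 ^ d)) (quot_trigraph V A h)"
  unfolding max_red_degree_le_def
proof
  define q' where "q' = merge u v q"
  define R where "R = (\<lambda>x y. joined V A h x y \<and> \<not> fully_joined V A h x y)"
  have symR: "symp R"
    using symp_joined[OF A, of V h] symp_fully_joined[OF A, of V h] by (auto simp: R_def symp_def)
  have sym: "A x y \<longleftrightarrow> A y x" for x y using A by (auto dest: sympD)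
  fix x assume "x \<in> tri_vertices (quot_trigraph V A h)"
  then obtain a0 where a0: "a0 \<in> V" "x = h a0" by (auto simp: quot_trigraph_def)
  define I where "I = q' a0"
  have ref: "refine V A q' a = refine V A q' b" if "a \<in> V" "b \<in> V" "h a = h b" for a b
    using h(2) that unfolding ker_le_def q'_def by blast
  have hq': "q' a = q' b" if "a \<in> V" "b \<in> V" "h a = h b" for a b
    using ref[OF that] by (simp add: refine_def)
  have hA: "A a s \<longleftrightarrow> A b s" if "a \<in> V" "b \<in> V" "h a = h b" "s \<in> singles V q'" for a b s
  proof -
    have "s \<in> nbs (singles V q') A a \<longleftrightarrow> s \<in> nbs (singles V q') A b"
      using ref[OF that(1-3)] by (simp add: refine_def)
    then show ?thesis using that(4) by (simp add: nbs_def)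
  qed
  define Y where "Y = {y \<in> h ` V. y \<noteq> x \<and> R x y}"
  define N where "N = nbs (q' ` V) (quot_adj V A q') I"
  have key: "I \<notin> q' ` singles V q' \<and> y \<in> (\<Union>J\<in>insert I N. h ` {a \<in> V. q' a = J})"
    if y: "y \<in> Y" for y
  proof -
    obtain a b where ab: "a \<in> V" "b \<in> V" "h a = x" "h b = y" "A a b"
      using y unfolding Y_def R_def joined_def by blast
    obtain a' b' where ab': "a' \<in> V" "b' \<in> V" "h a' = x" "h b' = y" "\<not> A a' b'"
      using y unfolding Y_def R_def fully_joined_def by blast
    have I: "q' a = I" "q' a' = I"
      using hq'[of a a0] hq'[of a' a0] a0 ab ab' by (simp_all add: I_def)
    \<comment> \<open>If the fibre were a single vertex \<open>s\<close>, both \<open>a\<close> and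
      \<open>a'\<close> would be \<open>s\<close>, but \<open>b\<close> and \<open>b'\<close> share
      a label and hence agree on \<open>s\<close>.\<close>
    have "I \<notin> q' ` singles V q'"
    proof
      assume "I \<in> q' ` singles V q'"
      then obtain s where s: "s \<in> singles V q'" "q' s = I" by blast
      then have "a = s" "a' = s" using singlesD[OF s(1)] I s(2) ab(1) ab'(1) by metis+
      then show False using hA[of b b' s] s ab ab' sym by simp
    qed
    moreover have "q' b = I \<or> q' b \<in> N"
      using ab I by (auto simp: N_def nbs_def quot_adj_def joined_def)
    ultimately show ?thesis using ab by blast
  qed
  have "card Y \<le> Suc d * (2 * 2 ^ d)"
  proof (cases "Y = {}")
    case False
    then have I: "I \<in> q' ` V - q' ` singles V q'" using key a0 by (auto simp: I_def)
    have finN: "finite N" using fin by (simp add: N_def finite_nbs)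
    have "card N \<le> d" using q(2) I by (auto simp: tame_def N_def q'_def)
    then have cN: "card (insert I N) \<le> Suc d" using finN by (simp add: card_insert_if)
    have "Y \<subseteq> (\<Union>J\<in>insert I N. h ` {a \<in> V. q' a = J})" using key by blast
    then have "card Y \<le> card (\<Union>J\<in>insert I N. h ` {a \<in> V. q' a = J})"
      using fin finN by (intro card_mono) auto
    also have "\<dots> \<le> (\<Sum>J\<in>insert I N. card (h ` {a \<in> V. q' a = J}))"
      using finN by (intro card_UN_le) simp
    also have "\<dots> \<le> (\<Sum>J\<in>insert I N. 2 * 2 ^ d)"
    proof (rule sum_mono)
      fix J
      \<comment> \<open>A fibre of \<open>q'\<close> meets at most two fibres of \<open>q\<close>,
        whence the factor 2; \<open>Suc d\<close> counts \<open>I\<close> along with its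
        neighbours.\<close>
      have "h ` {a \<in> V. q' a = J} \<subseteq> h ` {a \<in> V. q a = J} \<union> h ` {a \<in> V. q a = v}"
        by (auto simp: q'_def merge_def)
      then have "card (h ` {a \<in> V. q' a = J}) \<le>
          card (h ` {a \<in> V. q a = J} \<union> h ` {a \<in> V. q a = v})"
        using fin by (intro card_mono) auto
      also have "\<dots> \<le> card (h ` {a \<in> V. q a = J}) + card (h ` {a \<in> V. q a = v})"
        by (rule card_Un_le)
      also have "\<dots> \<le> 2 ^ d + 2 ^ d"
        by (intro add_mono card_image_fibre_le[OF fin q(1) h(1)])
      finally show "card (h ` {a \<in> V. q' a = J}) \<le> 2 * 2 ^ d" by simp
    qed
    also have "\<dots> \<le> Suc d * (2 * 2 ^ d)"
      unfolding sum_constant of_nat_id using cN by (rule mult_le_mono1)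
    finally show ?thesis .
  qed simp
  moreover have "{e \<in> edges_of (h ` V) R. x \<in> e} \<subseteq> (\<lambda>y. {x, y}) ` Y"
  proof
    fix e assume "e \<in> {e \<in> edges_of (h ` V) R. x \<in> e}"
    then obtain a b where ab: "e = {a, b}" "a \<in> h ` V" "b \<in> h ` V" "a \<noteq> b" "R a b" "x \<in> {a, b}"
      unfolding edges_of_def by blast
    then consider "x = a" "b \<in> Y" | "x = b" "a \<in> Y"
      using sympD[OF symR \<open>R a b\<close>] unfolding Y_def by blast
    then show "e \<in> (\<lambda>y. {x, y}) ` Y" using ab(1) by cases (auto simp: insert_commute)
  qed
  then have "card {e \<in> edges_of (h ` V) R. x \<in> e} \<le> card Y"
    using fin by (intro surj_card_le) (auto simp: Y_def)
  ultimately show "red_degree (quot_trigraph V A h) x \<le> Suc d * (2 * 2 ^ d)"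
    by (simp add: quot_trigraph_def R_def)
qed

text \<open>The merged fibre has at most \<open>d + d\<close> neighbours; other degrees do not grow,
  as \<open>v\<close> is merely replaced by \<open>u\<close>. Hence the invariant allows twice the
  degree of the merged pair.\<close>

lemma tame_merge:
  assumes fin: "finite V" and A: "symp A" and q: "tame (2 * d) V A q"
    and uv: "u \<in> q ` V" "v \<in> q ` V" "u \<noteq> v"
    and deg: "card (nbs (q ` V) (quot_adj V A q) u) \<le> d" "card (nbs (q ` V) (quot_adj V A q) v) \<le> d"
  shows "tame (2 * d) V A (merge u v q)"
  unfolding tame_def
proof
  define q' where "q' = merge u v q"
  define N where "N = nbs (q ` V) (quot_adj V A q)"
  define N' where "N' = nbs (q' ` V) (quot_adj V A q')"
  have X': "q' ` V = q ` V - {v}" using uv by (simp add: q'_def image_merge)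
  have finN: "finite (N x)" for x using fin by (simp add: N_def finite_nbs)
  fix x assume "x \<in> merge u v q ` V - merge u v q ` singles V (merge u v q)"
  then have x: "x \<in> q ` V" "x \<noteq> v" "x \<notin> q' ` singles V q'" using X' by (auto simp: q'_def)
  have "card (N' x) \<le> 2 * d"
  proof (cases "x = u")
    case True
    have "N' x \<subseteq> N u \<union> N v"
      unfolding N'_def X' using True uv A by (auto simp: N_def nbs_def q'_def quot_adj_merge)
    then have "card (N' x) \<le> card (N u \<union> N v)" using finN by (intro card_mono) auto
    also have "\<dots> \<le> card (N u) + card (N v)" by (rule card_Un_le)
    also have "\<dots> \<le> 2 * d" using deg by (simp add: N_def)
    finally show ?thesis .
  next
    case False
    have "x \<notin> q ` singles V q"
    proof
      assume "x \<in> q ` singles V q"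
      then obtain s where "s \<in> singles V q" "q s = x" by blast
      then have "s \<in> singles V q'" "q' s = x"
        using x(2) False by (auto simp: singles_def q'_def merge_def)
      then show False using x(3) by blast
    qed
    then have "card (N x) \<le> 2 * d" using q x(1) by (auto simp: tame_def N_def)
    moreover have "N' x \<subseteq> (\<lambda>z. if z = v then u else z) ` N x"
      unfolding N'_def X' using False x uv A
      by (auto simp: N_def nbs_def q'_def quot_adj_merge image_iff)
    then have "card (N' x) \<le> card (N x)" by (rule surj_card_le[OF finN])
    ultimately show ?thesis by simp
  qed
  then show "card (nbs (merge u v q ` V) (quot_adj V A (merge u v q)) x) \<le> 2 * d"
    by (simp add: N'_def q'_def)
qed

text \<open>In the quotient, merging adjacent labels is an edge contraction, and merging nonadjacent
  twins amounts to deleting \<open>v\<close>, so a complete minor would lift to the old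
  quotient.\<close>

lemma not_K_minor_merge:
  assumes A: "symp A" and uv: "u \<in> q ` V" "v \<in> q ` V" "u \<noteq> v"
    and free: "\<not> K_minor t (q ` V) (quot_adj V A q)"
    and uv': "quot_adj V A q u v \<or>
      nbs (q ` V) (quot_adj V A q) u = nbs (q ` V) (quot_adj V A q) v"
  shows "\<not> K_minor t (merge u v q ` V) (quot_adj V A (merge u v q))"
proof
  define B where "B = quot_adj V A q"
  have B: "symp B" using A by (simp add: B_def symp_quot_adj)
  assume "K_minor t (merge u v q ` V) (quot_adj V A (merge u v q))"
  then have minor: "K_minor t (q ` V - {v}) (quot_adj V A (merge u v q))"
    using uv by (simp add: image_merge)
  show False
  proof (cases "B u v")
    case True
    have "K_minor t (q ` V - {v}) (ctr u v B)"
      using minor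
      by (rule K_minor_mono_adj) (use uv A in \<open>auto simp: quot_adj_merge ctr_def B_def\<close>)
    then show False using free K_minor.contract[of u "q ` V" v B t] uv True by (simp add: B_def)
  next
    case False
    then have twin: "B u x \<longleftrightarrow> B v x" if "x \<in> q ` V" for x
      using uv' that by (auto simp: nbs_def B_def)
    have "K_minor t (q ` V - {v}) B"
      using minor
    proof (rule K_minor_mono_adj)
      fix x y assume xy: "x \<in> q ` V - {v}" "y \<in> q ` V - {v}" "x \<noteq> y"
        "quot_adj V A (merge u v q) x y"
      then have "B x y \<or> x = u \<and> B v y \<or> y = u \<and> B x v"
        using uv A by (auto simp: quot_adj_merge B_def)
      then show "B x y" using twin[of x] twin[of y] xy B by (auto dest: sympD)
    qed
    then show False using free K_minor.delete[of v "q ` V" t B] uv by (simp add: B_def)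
  qed
qed

text \<open>The bound of \<open>max_red_degree_between\<close> at
  \<open>d = 2 * low_bound t\<close>, the degree guaranteed by \<open>tame_merge\<close>.\<close>

definition tww_bound :: "nat \<Rightarrow> nat" where
  "tww_bound t = Suc (2 * low_bound t) * (2 * 2 ^ (2 * low_bound t))"

text \<open>Induction on the number of fibres of \<open>q\<close>, merging one pair at a time.
  \<open>f\<close> has the kernel of \<open>refine V A q\<close> but takes vertices as values, so
  that all trigraphs in the sequence have the same type.\<close>

lemma bounded_steps_to_singleton:
  fixes q f :: "'a \<Rightarrow> 'a"
  assumes "finite V" "V \<noteq> {}" "symp A"
    and "\<not> K_minor t (q ` V) (quot_adj V A q)" "tame (2 * low_bound t) V A q"
    and "ker_le V f (refine V A q)" "ker_le V (refine V A q) f"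
  shows "\<exists>T. (bounded_step (tww_bound t))\<^sup>*\<^sup>* (quot_trigraph V A f) T \<and> card (tri_vertices T) = 1"
  using assms
proof (induction "card (q ` V)" arbitrary: q f rule: less_induct)
  case less
  note fin = less.prems(1) and A = less.prems(3)
  show ?case
  proof (cases "1 < card (q ` V)")
    case False
    then have "card (q ` V) \<le> Suc 0" by simp
    then have q: "q a = q b" if "a \<in> V" "b \<in> V" for a b
      using that card_le_Suc0_iff_eq[OF finite_imageI[OF fin, of q]] by blast
    obtain a0 where a0: "a0 \<in> V" using less.prems(2) by blast
    have "f a = f a0" if "a \<in> V" for a
    proof -
      \<comment> \<open>With one fibre left, a singleton fibre exists only if \<open>V\<close> has
        one vertex; otherwise all these neighbourhoods are empty. Either way the refinement is
        constant.\<close>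
      have "a = s \<and> a0 = s" if "s \<in> singles V q" for s
        using singlesD[OF that] q that \<open>a \<in> V\<close> a0 unfolding singles_def by blast
      then have "nbs (singles V q) A a = nbs (singles V q) A a0" unfolding nbs_def by blast
      then have "refine V A q a = refine V A q a0" using q that a0 unfolding refine_def by blast
      then show ?thesis using less.prems(7) that a0 unfolding ker_le_def by blast
    qed
    then have "f ` V = {f a0}" using a0 by blast
    then have "card (tri_vertices (quot_trigraph V A f)) = 1" by (simp add: quot_trigraph_def)
    then show ?thesis by blast
  next
    case True
    obtain u v where uv: "u \<in> q ` V" "v \<in> q ` V" "u \<noteq> v"
      and deg: "card (nbs (q ` V) (quot_adj V A q) u) \<le> low_bound t"
        "card (nbs (q ` V) (quot_adj V A q) v) \<le> low_bound t"
      and uv': "quot_adj V A q u v \<or>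
        nbs (q ` V) (quot_adj V A q) u = nbs (q ` V) (quot_adj V A q) v"
      using ex_contractible_pair[OF _ True symp_quot_adj[OF A] irreflp_quot_adj less.prems(4)] fin
      by blast
    define q' where "q' = merge u v q"
    have free: "\<not> K_minor t (q' ` V) (quot_adj V A q')"
      unfolding q'_def by (rule not_K_minor_merge[OF A uv less.prems(4) uv'])
    have tame: "tame (2 * low_bound t) V A q'"
      unfolding q'_def by (rule tame_merge[OF fin A less.prems(5) uv deg])
    have ker: "ker_le V f (refine V A q')"
      using less.prems(6) ker_le_refine_merge[of V A q u v] unfolding q'_def ker_le_def by blast
    have "max_red_degree_le (tww_bound t) (quot_trigraph V A h)"
      if "ker_le V f h" "ker_le V h (refine V A q')" for h :: "'a \<Rightarrow> 'a"
    proof -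
      have "ker_le V (refine V A q) h" using that(1) less.prems(7) unfolding ker_le_def by blast
      then show ?thesis unfolding tww_bound_def
        by (rule max_red_degree_between[OF fin A less.prems(5) tame[unfolded q'_def]])
          (use that(2) in \<open>simp add: q'_def\<close>)
    qed
    then obtain f' :: "'a \<Rightarrow> 'a" where f': "ker_le V f' (refine V A q')" "ker_le V (refine V A q') f'"
      "(bounded_step (tww_bound t))\<^sup>*\<^sup>* (quot_trigraph V A f) (quot_trigraph V A f')"
      using bounded_steps_coarsen[OF fin A ker] by blast
    have "q' ` V = q ` V - {v}" unfolding q'_def using uv by (intro image_merge) auto
    then have "card (q' ` V) < card (q ` V)"
      using uv fin by (simp only: card_Diff1_less finite_imageI)
    then obtain T where T: "(bounded_step (tww_bound t))\<^sup>*\<^sup>* (quot_trigraph V A f') T"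
      "card (tri_vertices T) = 1"
      using less.hyps[of q' f'] less.prems(1-3) free tame f' by blast
    have "(bounded_step (tww_bound t))\<^sup>*\<^sup>* (quot_trigraph V A f) T"
      using f'(3) T(1) by (rule rtranclp_trans)
    then show ?thesis using T(2) by blast
  qed
qed

text \<open>The chain starts at the identity labelling: all fibres are singletons, so tameness is
  vacuous, and the quotient trigraph is \<open>G\<close> itself without red edges.\<close>

lemma twin_width_K_minor_free_le:
  fixes G :: "'a graph"
  assumes "finite_simple_graph G" "vertices G \<noteq> {}" "K_minor_free t G"
  shows "twin_width G \<le> tww_bound t"
proof -
  obtain V E where G: "G = (V, E)" by (cases G)
  define A where "A = (\<lambda>x y. {x, y} \<in> E)"
  have V: "finite V" "V \<noteq> {}" and E: "E \<subseteq> nsets V 2" using assms by (auto simp: G)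
  have A: "symp A" "irreflp A"
    using subsetD[OF E, of "{x, x}" for x]
    by (auto simp: A_def symp_def irreflp_def insert_commute nsets_def)
  have E_eq: "edges_of V A = E"
  proof
    show "edges_of V A \<subseteq> E" by (auto simp: edges_of_def A_def)
    show "E \<subseteq> edges_of V A"
    proof
      fix e assume "e \<in> E"
      moreover from this obtain x y where "e = {x, y}" "x \<in> V" "y \<in> V" "x \<noteq> y"
        using E by (blast elim: nsets2_E)
      ultimately show "e \<in> edges_of V A" by (auto simp: edges_of_def A_def)
    qed
  qed
  have free: "\<not> K_minor t V A"
    using K_minor_imp_minor_step[OF _ A(1), of t V] assms(3)
    by (auto simp: K_minor_free_def G E_eq)
  have joined: "joined V A id x y \<longleftrightarrow> x \<in> V \<and> y \<in> V \<and> A x y"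
    "fully_joined V A id x y \<longleftrightarrow> (x \<in> V \<longrightarrow> y \<in> V \<longrightarrow> A x y)" for x y
    by (auto simp: joined_def fully_joined_def)
  have "\<not> K_minor t (id ` V) (quot_adj V A id)"
    using free K_minor_mono_adj[of t V "quot_adj V A id" A] by (auto simp: quot_adj_def joined)
  moreover have "singles V id = V" by (auto simp: singles_def)
  then have "tame (2 * low_bound t) V A id" by (simp add: tame_def)
  ultimately obtain T where
    T: "(bounded_step (tww_bound t))\<^sup>*\<^sup>* (quot_trigraph V A id) T" "card (tri_vertices T) = 1"
    using bounded_steps_to_singleton[OF V A(1), of t id id]
    by (auto simp: ker_le_def refine_def)
  have "quot_trigraph V A id = trigraph_of G"
    using E_eq by (auto simp: quot_trigraph_def G joined edges_of_def)
  then show ?thesis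
    using T by (intro twin_width_le) (auto simp: G max_red_degree_le_def)
qed

subsection \<open>Numerical bounds\<close>

text \<open>With \<open>d = 2 ^ Suc t\<close> the threshold is at most
  \<open>2 ^ (2 * d + 2)\<close>; here \<open>d \<le> h_bound t\<close>, and \<open>g_bound\<close>
  is quadratic in \<open>h_bound\<close>.\<close>

lemma low_bound_le: "low_bound t \<le> 2 ^ (4 * g_bound t)"
proof -
  define d :: nat where "d = 2 ^ Suc t"
  have "d + 1 \<le> 2 ^ d" using less_exp[of d] by (simp add: Suc_le_eq)
  then have "low_bound t \<le> 2 * d * (2 * 2 ^ d)"
    unfolding low_bound_def d_def[symmetric] by (intro mult_le_mono2) simp
  also have "\<dots> \<le> 2 * 2 ^ d * (2 * 2 ^ d)" using less_exp[of d] by simp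
  also have "\<dots> = 2 ^ (2 * d + 2)" by (simp add: power_add power_even_eq power2_eq_square)
  also have "\<dots> \<le> 2 ^ (4 * g_bound t)"
  proof (rule power_increasing)
    have "d \<le> h_bound t"
      unfolding d_def h_bound_def
      using power_increasing[of "Suc t" "4 * t + 1" "2::nat"] by linarith
    moreover have "2 \<le> h_bound t" by (simp add: h_bound_def)
    moreover have "h_bound t * 1 \<le> h_bound t * h_bound t"
      using \<open>2 \<le> h_bound t\<close> by (intro mult_le_mono2) simp
    ultimately show "2 * d + 2 \<le> 4 * g_bound t"
      unfolding g_bound_def power2_eq_square by linarith
  qed simp
  finally show ?thesis .
qed

lemma c_bound_ge: "2 ^ (4 * k) \<le> c_bound k"
proof -
  have "1\<^sup>2 \<le> (real k + 1)\<^sup>2" by (intro power_mono) auto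
  then have "1 \<le> 8 / 3 * (real k + 1)\<^sup>2" unfolding one_power2 by linarith
  then have "1 * 2 ^ (4 * k) \<le> 8 / 3 * (real k + 1)\<^sup>2 * (2 ^ (4 * k) :: real)"
    by (rule mult_right_mono) simp
  then show ?thesis by (simp add: c_bound_def)
qed

text \<open>For \<open>m = low_bound t\<close> one has \<open>m \<le> c\<close>, and
  \<open>(2 * m + 1) * 2 powr (2 * m + 1)\<close> is compared with \<open>f_bound t\<close> factor
  by factor; \<open>1 \<le> c\<close> absorbs the summand 1 of the first factor.\<close>

lemma tww_bound_le: "real (tww_bound t) \<le> f_bound t"
proof -
  define c where "c = c_bound (g_bound t)"
  define m where "m = low_bound t"
  have "real m \<le> 2 ^ (4 * g_bound t)"
    unfolding m_def using low_bound_le[of t] by (metis of_nat_le_iff of_nat_numeral of_nat_power)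
  then have mc: "real m \<le> c" unfolding c_def using c_bound_ge order_trans by blast
  have c1: "1 \<le> c"
    unfolding c_def using c_bound_ge[of "g_bound t"] one_le_power[of "2::real" "4 * g_bound t"]
    by linarith
  have "real (tww_bound t) = (2 * real m + 1) * (2 * 2 powr (2 * real m))"
    using powr_realpow[of 2 "2 * m"] by (simp add: tww_bound_def m_def algebra_simps)
  also have "2 * 2 powr (2 * real m) = 2 powr (2 * real m + 1)" by (simp add: powr_add)
  also have "(2 * real m + 1) * \<dots> \<le> (4 * c) * 2 powr (4 * c + 2)"
    using mc c1 by (intro mult_mono powr_mono) auto
  finally show ?thesis by (simp add: f_bound_def c_def)
qed

text \<open>The witness is the threefold binary logarithm. Each logarithm is bounded from below, to
  keep the next one meaningful, and from above, to reach linear growth.\<close>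

lemma f_bound_iterated_log:
  "\<exists>e :: nat \<Rightarrow> real. e \<in> O(\<lambda>t. real t) \<and> (\<forall>t. f_bound t = 2 powr (2 powr (2 powr (e t))))"
proof -
  define c where "c t = c_bound (g_bound t)" for t
  define e where "e t = log 2 (log 2 (log 2 (f_bound t)))" for t
  have g: "32 \<le> g_bound t" "g_bound t \<le> 2 ^ (8 * t + 7)" for t
  proof -
    have "4 \<le> h_bound t"
      using power_increasing[of 1 "4 * t + 1" "2::nat"] by (simp add: h_bound_def)
    then have "4\<^sup>2 \<le> (h_bound t)\<^sup>2" by (intro power_mono) auto
    then show "32 \<le> g_bound t" by (simp add: g_bound_def)
    have "h_bound t \<le> 2 ^ (4 * t + 3)"
      using one_le_power[of "2::nat" "4 * t"] by (simp add: h_bound_def power_add)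
    then have "(h_bound t)\<^sup>2 \<le> (2 ^ (4 * t + 3))\<^sup>2" by (intro power_mono) auto
    also have "\<dots> = 2 ^ (8 * t + 6)" by (simp add: power_mult[symmetric] algebra_simps)
    finally show "g_bound t \<le> 2 ^ (8 * t + 7)" by (simp add: g_bound_def power_add)
  qed
  have c: "2 \<le> c t" "c t \<le> 2 powr (8 * real (g_bound t))" for t
  proof -
    have "(2::real) ^ 1 \<le> 2 ^ (4 * g_bound t)" using g(1)[of t] by (intro power_increasing) auto
    then show "2 \<le> c t" using c_bound_ge[of "g_bound t"] by (simp add: c_def)
    define k where "k = g_bound t"
    have "k + 1 \<le> 2 ^ k" using less_exp[of k] by (simp add: Suc_le_eq)
    then have "real (k + 1) \<le> real (2 ^ k)" by (simp only: of_nat_le_iff)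
    then have "real k + 1 \<le> 2 ^ k" by simp
    then have "(real k + 1)\<^sup>2 \<le> (2 ^ k)\<^sup>2" by (intro power_mono) auto
    also have "\<dots> = 2 ^ (2 * k)" by (simp add: power_mult[symmetric] mult.commute)
    finally have "c t \<le> 2 ^ 2 * 2 ^ (2 * k) * 2 ^ (4 * k)"
      unfolding c_def c_bound_def k_def[symmetric] by (intro mult_mono) auto
    also have "\<dots> = 2 ^ (2 + 2 * k + 4 * k)" by (simp only: power_add)
    also have "\<dots> \<le> 2 ^ (8 * k)" using g(1)[of t] by (intro power_increasing) (auto simp: k_def)
    also have "\<dots> = 2 powr (8 * real k)" by (simp add: powr_realpow[symmetric])
    finally show "c t \<le> 2 powr (8 * real (g_bound t))" by (simp add: k_def)
  qed
  have f: "2 powr (4 * c t) \<le> f_bound t" "f_bound t \<le> 2 powr (8 * c t)" for t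
  proof -
    have "1 * 2 powr (4 * c t) \<le> (4 * c t) * 2 powr (4 * c t + 2)"
      using c(1)[of t] by (intro mult_mono powr_mono) auto
    then show "2 powr (4 * c t) \<le> f_bound t" by (simp add: f_bound_def c_def)
    \<comment> \<open>The factor \<open>4 * c t\<close> moves into the exponent by way of
      \<open>c t \<le> exp (c t) \<le> 4 powr c t\<close>.\<close>
    have "c t \<le> exp (c t)" using exp_ge_add_one_self[of "c t"] by linarith
    also have "exp (c t) = exp 1 powr c t" by (simp add: powr_def)
    also have "\<dots> \<le> 4 powr c t" using exp_le c(1)[of t] by (intro powr_mono2) auto
    also have "4 powr c t = (2 powr 2) powr c t" by simp
    also have "\<dots> = 2 powr (2 * c t)" by (simp only: powr_powr)
    finally have "4 * c t \<le> 2 powr (2 * c t + 2)" by (simp add: powr_add)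
    then have "f_bound t \<le> 2 powr (2 * c t + 2) * 2 powr (4 * c t + 2)"
      unfolding f_bound_def c_def[symmetric] by (intro mult_right_mono) auto
    also have "\<dots> = 2 powr (6 * c t + 4)" by (simp add: powr_add[symmetric])
    also have "\<dots> \<le> 2 powr (8 * c t)" using c(1)[of t] by (intro powr_mono) auto
    finally show "f_bound t \<le> 2 powr (8 * c t)" .
  qed
  have f0: "0 < f_bound t" for t using f(1)[of t] by (smt (verit) powr_gt_zero)
  have l1: "4 * c t \<le> log 2 (f_bound t)" "log 2 (f_bound t) \<le> 8 * c t" for t
    using f[of t] f0[of t] by (simp_all add: le_log_iff log_le_iff)
  have l2: "1 \<le> log 2 (log 2 (f_bound t))" "log 2 (log 2 (f_bound t)) \<le> 16 * real (g_bound t)" for t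
  proof -
    have "2 \<le> log 2 (f_bound t)" using l1(1)[of t] c(1)[of t] by linarith
    then show "1 \<le> log 2 (log 2 (f_bound t))" by (simp add: le_log_iff)
    have "log 2 (f_bound t) \<le> 2 powr 3 * 2 powr (8 * real (g_bound t))"
      using l1(2)[of t] c(2)[of t] by simp
    also have "\<dots> = 2 powr (3 + 8 * real (g_bound t))" by (simp only: powr_add)
    also have "\<dots> \<le> 2 powr (16 * real (g_bound t))" using g(1)[of t] by (intro powr_mono) auto
    finally show "log 2 (log 2 (f_bound t)) \<le> 16 * real (g_bound t)"
      using \<open>2 \<le> log 2 (f_bound t)\<close> by (simp add: log_le_iff)
  qed
  have e: "0 \<le> e t" "e t \<le> 8 * real t + 11" for t
  proof -
    show "0 \<le> e t" using l2(1)[of t] by (simp add: e_def)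
    have "real (g_bound t) \<le> real (2 ^ (8 * t + 7))" using g(2)[of t] by (simp only: of_nat_le_iff)
    then have "log 2 (log 2 (f_bound t)) \<le> 16 * 2 ^ (8 * t + 7)"
      using l2(2)[of t] unfolding of_nat_power of_nat_numeral by linarith
    also have "\<dots> = 2 ^ (8 * t + 11)" by (simp add: power_add)
    also have "\<dots> = 2 powr (8 * real t + 11)" by (simp add: powr_realpow[symmetric])
    finally show "e t \<le> 8 * real t + 11" using l2(1)[of t] by (simp add: e_def log_le_iff)
  qed
  \<comment> \<open>\<open>19 = 8 + 11\<close>: from \<open>t = 1\<close> on, the constant 11 is
    absorbed into the linear term.\<close>
  have "norm (e t) \<le> 19 * norm (real t)" if "1 \<le> t" for t
    using e[of t] that by simp
  then have "e \<in> O(\<lambda>t. real t)"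
    by (intro bigoI[of _ 19]) (auto simp: eventually_at_top_linorder)
  moreover have "f_bound t = 2 powr (2 powr (2 powr (e t)))" for t
  proof -
    have "0 < log 2 (f_bound t)" using l1(1)[of t] c(1)[of t] by linarith
    moreover have "0 < log 2 (log 2 (f_bound t))" using l2(1)[of t] by linarith
    moreover have "2 powr log 2 x = x" if "0 < x" for x :: real using that by simp
    ultimately show ?thesis using f0[of t] unfolding e_def by presburger
  qed
  ultimately show ?thesis by blast
qed

theorem theorem6p3:
  shows "(\<forall>(t::nat) (G::'a graph).
            finite_simple_graph G \<and> vertices G \<noteq> {} \<and> K_minor_free t G \<longrightarrow>
            real (twin_width G) \<le> f_bound t) \<and>
         (\<exists>e :: nat \<Rightarrow> real. e \<in> O(\<lambda>t. real t) \<and>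
            (\<forall>t. f_bound t = 2 powr (2 powr (2 powr (e t)))))"
proof
  show "\<forall>(t::nat) (G::'a graph).
      finite_simple_graph G \<and> vertices G \<noteq> {} \<and> K_minor_free t G \<longrightarrow>
      real (twin_width G) \<le> f_bound t"
  proof (intro allI impI)
    fix t :: nat and G :: "'a graph"
    assume "finite_simple_graph G \<and> vertices G \<noteq> {} \<and> K_minor_free t G"
    then have "real (twin_width G) \<le> real (tww_bound t)"
      using twin_width_K_minor_free_le of_nat_mono by blast
    then show "real (twin_width G) \<le> f_bound t" using tww_bound_le order_trans by blast
  qed
qed (rule f_bound_iterated_log)

end
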